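(* Let $n\ge 1$ and let $d \geq 2$ be even. For each partition $\boldsymbol{\pi}=(\pi_1, \pi_2, \ldots,\pi_r)$ of $d$, define $\mathrm{T}_{\boldsymbol{\pi}} : \mathrm{M}_{n}(\mathbb{C})\to \mathbb{R}$ by setting $\mathrm{T}_{\boldsymbol{\pi}}(A)$ to be $1/\binom{d}{d/2}$ times the sum over the $\binom{d}{d/2}$ possible locations to place $d/2$ adjoints ${}^*$ among the $d$ copies of $A$ in $$(\operatorname{tr} \underbrace{AA\cdots A}_{\pi_1})(\operatorname{tr} \underbrace{AA\cdots A}_{\pi_2})\cdots(\operatorname{tr} \underbrace{AA\cdots A}_{\pi_r}).$$ Then $$|\!|\!| A |\!|\!|_{d}= \bigg( \sum_{\boldsymbol{\pi} \,\vdash\, d} \frac{\mathrm{T}_{\boldsymbol{\pi}}(A)}{z_{\boldsymbol{\pi}}}\bigg)^{1/d},$$ in which the sum runs over all partitions $\boldsymbol{\pi}$ of $d$, is a norm on $\mathrm{M}_n(\mathbb{C})$ that restricts on $\mathrm{H}_n(\mathbb{C})$ to the norm $A\mapsto \big( h_{d}(\lambda_1(A), \lambda_2(A), \ldots, \lambda_n(A))\big)^{1/d}$.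
   Context: $\mathrm{M}_n(\mathbb{C})$ is the complex vector space of $n\times n$ complex matrices, $A^*$ is the conjugate transpose of $A$, and $\mathrm{H}_n(\mathbb{C})=\{A\in \mathrm{M}_n(\mathbb{C}):A=A^*\}$ is regarded as a real vector space. For $A\in \mathrm{H}_n(\mathbb{C})$, $\lambda_1(A)\ge\cdots\ge\lambda_n(A)$ are its eigenvalues with multiplicity. The complete homogeneous symmetric polynomial is $h_d(x_1,\ldots,x_n)=\sum_{1\le i_1\le\cdots\le i_d\le n}x_{i_1}\cdots x_{i_d}$. A partition of $d$, written $\boldsymbol{\pi}\vdash d$, is an $r$-tuple $(\pi_1,\ldots,\pi_r)$ of positive integers with $\pi_1\ge\cdots\ge\pi_r$ and $\pi_1+\cdots+\pi_r=d$ ($r$ depends on $\boldsymbol{\pi}$). Set $z_{\boldsymbol{\pi}}=\prod_{i\ge1} i^{m_i}m_i!$, where $m_i$ is the multiplicity of $i$ in $\boldsymbol{\pi}$. Placing adjoints means choosing a subset of size $d/2$ of the $d$ positions and replacing $A$ by $A^*$ in those positions. For example, $\mathrm{T}_{(2)}(A)=\frac12(\operatorname{tr}(A^*A)+\operatorname{tr}(AA^* ))$ and $\mathrm{T}_{(1,1)}(A)=\frac12\big((\operatorname{tr}A^* )(\operatorname{tr}A)+(\operatorname{tr}A)(\operatorname{tr}A^* )\big)$. *)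

theory Defs
  imports
    "Jordan_Normal_Form.Schur_Decomposition"
    "HOL-Computational_Algebra.Fundamental_Theorem_Algebra"
begin

definition mat_trace :: "'a::comm_monoid_add mat \<Rightarrow> 'a" where
  "mat_trace A = (\<Sum>i<dim_row A. A $$ (i, i))"

definition hermitian_mats :: "nat \<Rightarrow> complex mat set" where
  "hermitian_mats n = {A \<in> carrier_mat n n. mat_adjoint A = A}"

text \<open>
  The eigenvalues of a Hermitian matrix in weakly decreasing order, repeated according to
  multiplicity.  Applying \<^const>\<open>Re\<close> only changes the type: see the lemma
  \<open>hermitian_eigvals_desc\<close> below.
\<close>

definition eigvals_desc :: "complex mat \<Rightarrow> real list" where
  "eigvals_desc A = rev (sorted_list_of_multiset (image_mset Re (proots (char_poly A))))"

definition eigval :: "nat \<Rightarrow> complex mat \<Rightarrow> real" where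
  "eigval i A = eigvals_desc A ! (i - 1)"

lemma mat_adjoint_index:
  "i < dim_col A \<Longrightarrow> j < dim_row A \<Longrightarrow> mat_adjoint A $$ (i, j) = conjugate (A $$ (j, i))"
  by (simp add: mat_adjoint_def mat_of_rows_index)

lemma hermitian_eigenvalue_real:
  assumes A: "A \<in> hermitian_mats n" and ev: "eigenvalue A e"
  shows "e \<in> \<real>"
proof -
  have Ac: "A \<in> carrier_mat n n" and adj: "mat_adjoint A = A"
    using A by (auto simp: hermitian_mats_def)
  obtain v where v: "v \<in> carrier_vec n" "v \<noteq> 0\<^sub>v n" "A *\<^sub>v v = e \<cdot>\<^sub>v v"
    using ev Ac by (auto simp: eigenvalue_def eigenvector_def)
  have sym: "cnj (A $$ (i, j)) = A $$ (j, i)" if "i < n" "j < n" for i j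
    using mat_adjoint_index[of j A i] adj Ac that by simp
  have comp: "e * v $ i = (\<Sum>j<n. A $$ (i, j) * v $ j)" if "i < n" for i
  proof -
    have "(A *\<^sub>v v) $ i = (\<Sum>j<n. A $$ (i, j) * v $ j)"
      using that Ac v(1) by (simp add: scalar_prod_def row_def atLeast0LessThan)
    then show ?thesis using v(1,3) that by simp
  qed
  define s where "s = (\<Sum>i<n. v $ i * cnj (v $ i))"
  define q where "q = (\<Sum>i<n. \<Sum>j<n. cnj (v $ i) * (A $$ (i, j) * v $ j))"
  have "e * s = (\<Sum>i<n. cnj (v $ i) * (e * v $ i))"
    unfolding s_def sum_distrib_left by (simp add: mult_ac)
  also have "\<dots> = q"
    unfolding q_def by (intro sum.cong) (simp_all add: comp sum_distrib_left)
  finally have es: "e * s = q" .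
  have "cnj q = (\<Sum>i<n. \<Sum>j<n. cnj (v $ j) * (A $$ (j, i) * v $ i))"
    unfolding q_def cnj_sum
    by (intro sum.cong refl) (simp add: sym mult_ac)
  also have "\<dots> = q"
    unfolding q_def by (subst sum.swap) simp
  finally have qr: "cnj q = q" .
  have sr: "s = of_real (\<Sum>i<n. (cmod (v $ i))\<^sup>2)"
    by (simp add: s_def complex_norm_square del: of_real_power)
  have "s \<noteq> 0"
  proof
    assume "s = 0"
    then have "(\<Sum>i<n. (cmod (v $ i))\<^sup>2) = 0" by (simp only: sr of_real_eq_0_iff)
    then have "\<forall>i<n. v $ i = 0" by (simp add: sum_nonneg_eq_0_iff)
    then show False using v(1,2) by (auto intro!: eq_vecI)
  qed
  moreover have "cnj s = s" by (simp add: sr)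
  ultimately have "cnj e = e"
    using es qr by (metis complex_cnj_mult mult_right_cancel)
  then show ?thesis using Reals_cnj_iff by blast
qed

lemma hermitian_eigvals_desc:
  assumes A: "A \<in> hermitian_mats n"
  shows "image_mset complex_of_real (mset (eigvals_desc A)) = proots (char_poly A)"
    and "length (eigvals_desc A) = n"
    and "sorted_wrt (\<ge>) (eigvals_desc A)"
proof -
  have Ac: "A \<in> carrier_mat n n" using A by (auto simp: hermitian_mats_def)
  have deg: "degree (char_poly A) = n" "char_poly A \<noteq> 0"
    using degree_monic_char_poly[OF Ac] by auto
  have "of_real (Re x) = x" if "x \<in># proots (char_poly A)" for x
    using that deg hermitian_eigenvalue_real[OF A, of x] eigenvalue_root_char_poly[OF Ac, of x]
    by (auto simp: of_real_Re)
  then have "image_mset (\<lambda>x. complex_of_real (Re x)) (proots (char_poly A)) = proots (char_poly A)"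
    using image_mset_cong[of "proots (char_poly A)" "\<lambda>x. complex_of_real (Re x)" id] by simp
  then show "image_mset complex_of_real (mset (eigvals_desc A)) = proots (char_poly A)"
    by (simp add: eigvals_desc_def image_mset.compositionality comp_def)
  have "length (eigvals_desc A) = size (mset (eigvals_desc A))" by simp
  also have "\<dots> = n"
    by (simp add: eigvals_desc_def size_proots_complex deg del: size_mset)
  finally show "length (eigvals_desc A) = n" .
  show "sorted_wrt (\<ge>) (eigvals_desc A)"
    by (simp add: eigvals_desc_def sorted_wrt_rev)
qed

text \<open>
  \<open>V\<close> is a space of \<open>n \<times> n\<close> matrices and \<open>K\<close> its field of scalars: all complex
  numbers, or the reals viewed inside the complex numbers.
\<close>

definition mat_norm_on :: "complex set \<Rightarrow> nat \<Rightarrow> complex mat set \<Rightarrow> (complex mat \<Rightarrow> real) \<Rightarrow> bool" where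
  "mat_norm_on K n V N \<longleftrightarrow>
     (\<forall>A\<in>V. 0 \<le> N A) \<and>
     (\<forall>A\<in>V. N A = 0 \<longleftrightarrow> A = 0\<^sub>m n n) \<and>
     (\<forall>c\<in>K. \<forall>A\<in>V. N (c \<cdot>\<^sub>m A) = cmod c * N A) \<and>
     (\<forall>A\<in>V. \<forall>B\<in>V. N (A + B) \<le> N A + N B)"

definition complete_hom :: "nat \<Rightarrow> nat \<Rightarrow> (nat \<Rightarrow> 'a::comm_semiring_1) \<Rightarrow> 'a" where
  "complete_hom d n x =
     (\<Sum>is\<in>{is. length is = d \<and> sorted is \<and> set is \<subseteq> {1..n}}. \<Prod>i\<leftarrow>is. x i)"

lemma finite_complete_hom_index:
  "finite {is :: nat list. length is = d \<and> sorted is \<and> set is \<subseteq> {1..n}}"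
  by (rule finite_subset[OF _ finite_lists_length_eq[of "{1..n}" d]]) auto

definition partitions :: "nat \<Rightarrow> nat list set" where
  "partitions d = {\<pi>. sorted_wrt (\<ge>) \<pi> \<and> (\<forall>p\<in>set \<pi>. 0 < p) \<and> sum_list \<pi> = d}"

definition partition_z :: "nat list \<Rightarrow> nat" where
  "partition_z \<pi> = (\<Prod>i\<in>set \<pi>. i ^ count_list \<pi> i * fact (count_list \<pi> i))"

lemma finite_partitions: "finite (partitions d)"
proof (rule finite_subset)
  show "partitions d \<subseteq> {\<pi>. set \<pi> \<subseteq> {..d} \<and> length \<pi> \<le> d}"
  proof clarify
    fix \<pi> assume \<pi>: "\<pi> \<in> partitions d"
    have "length xs \<le> sum_list xs" if "\<forall>p\<in>set xs. 0 < p" for xs :: "nat list"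
      using that by (induction xs) auto
    then show "set \<pi> \<subseteq> {..d} \<and> length \<pi> \<le> d"
      using \<pi> member_le_sum_list[of _ \<pi>] by (auto simp: partitions_def)
  qed
  show "finite {\<pi>. set \<pi> \<subseteq> {..d} \<and> length \<pi> \<le> d}"
    by (rule finite_lists_length_le) simp
qed

text \<open>
  The \<open>d\<close> copies of \<open>A\<close> are numbered \<open>0, \<dots>, d - 1\<close> from left to right, and \<open>S\<close>
  is the set of positions carrying an adjoint.
\<close>

definition adjoint_word :: "complex mat \<Rightarrow> nat set \<Rightarrow> nat list \<Rightarrow> complex mat" where
  "adjoint_word A S ps =
     foldr (\<lambda>p M. (if p \<in> S then mat_adjoint A else A) * M) ps (1\<^sub>m (dim_row A))"

text \<open>The positions occupied by the \<open>k\<close>-th trace factor (counted from \<open>0\<close>).\<close>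

definition block_positions :: "nat list \<Rightarrow> nat \<Rightarrow> nat list" where
  "block_positions \<pi> k = [sum_list (take k \<pi>) ..< sum_list (take (Suc k) \<pi>)]"

definition trace_poly :: "nat list \<Rightarrow> complex mat \<Rightarrow> complex" where
  "trace_poly \<pi> A =
     (let d = sum_list \<pi> in
      1 / of_nat (d choose (d div 2)) *
      (\<Sum>S | S \<subseteq> {..<d} \<and> card S = d div 2.
         \<Prod>k<length \<pi>. mat_trace (adjoint_word A S (block_positions \<pi> k))))"

text \<open>
  Taking \<^const>\<open>Re\<close> is harmless because \<^const>\<open>trace_poly\<close> is real-valued for even
  \<open>d\<close>.  For \<open>d > 0\<close>, even or odd, \<open>root d\<close> preserves signs, so a nonnegative value
  of \<open>triple_norm\<close> means that the radicand is nonnegative.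
\<close>

definition triple_norm :: "nat \<Rightarrow> complex mat \<Rightarrow> real" where
  "triple_norm d A = root d (\<Sum>\<pi>\<in>partitions d. Re (trace_poly \<pi> A) / real (partition_z \<pi>))"

definition hermitian_chs_norm :: "nat \<Rightarrow> nat \<Rightarrow> complex mat \<Rightarrow> real" where
  "hermitian_chs_norm d n A = root d (complete_hom d n (\<lambda>i. eigval i A))"

end

theory Submission
  imports Defs "HOL-Probability.Distributions"
begin

text \<open>
  The proof exhibits the norm as an \<open>L^d\<close> norm.  Let \<open>z\<close> be a standard complex Gaussian vector in
  \<open>n\<close>-space and write \<open>q(A) = z* A z\<close>, a random variable that depends linearly on \<open>A\<close>.  The
  radicand in the definition of the triple norm turns out to be the expectation of \<open>|q(A)|^d\<close>,
  divided by \<open>d!\<close>.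

  The bridge is the identity \<open>E[q(A)^d] / d! = (\<Sum>\<pi>. (\<Prod>i. tr (A^(\<pi> i))) / z \<pi>)\<close>, valid for every complex
  matrix \<open>A\<close> and every \<open>d\<close> (\<open>gaussian_moment_cycle_index\<close>).  Gaussian integration by parts
  trades a factor \<open>cnj (z j)\<close> for the Wirtinger derivative in \<open>z j\<close>, and this shows that the
  numbers \<open>H m = E[q(A)^m] / m!\<close> satisfy Newton's recursion
  \<open>m * H m = (\<Sum>k = 1..m. tr (A^k) * H (m - k))\<close>.  Removing one part from a partition shows that the
  right-hand side of the identity obeys the same recursion, which together with the value at \<open>0\<close>
  determines the sequence.  The polynomials \<open>h m\<close> of the eigenvalues of a Hermitian \<open>A\<close> obey it
  as well, because \<open>tr (A^k)\<close> is their \<open>k\<close>-th power sum.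

  The adjoints are brought in by polarisation.  The form of \<open>A + u A*\<close> is \<open>q(A) + u * cnj (q(A))\<close>, so
  the coefficient of \<open>u^(d/2)\<close> on the Gaussian side of the identity is a binomial coefficient
  times \<open>E[|q(A)|^d] / d!\<close>; on the trace side, expanding each power of \<open>A + u A*\<close> into words in \<open>A\<close>
  and \<open>A*\<close> produces exactly the placements of \<open>d/2\<close> adjoints
  (\<open>sum_trace_poly_eq_gaussian_abs_moment\<close>).

  The norm axioms follow.  Homogeneity is clear, the triangle inequality is
  Minkowski's inequality, and definiteness comes from the second moment
  \<open>E[|q(A)|^2] = |tr A|^2 + (\<Sum>i j. |A i j|^2)\<close>.  For Hermitian \<open>A\<close> the form is real, so for even \<open>d\<close> the
  absolute moment is an ordinary moment and hence equals \<open>h d\<close> of the eigenvalues.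
\<close>

section \<open>Newton's recursion\<close>

text \<open>
  Every identity between moments, symmetric functions and sums over partitions below is proved by
  showing that both sides obey this recursion.
\<close>

lemma newton_recursion_unique:
  fixes a b p :: "nat \<Rightarrow> 'a::field_char_0"
  assumes "a 0 = b 0"
    and a: "\<And>m. of_nat (Suc m) * a (Suc m) = (\<Sum>k\<le>m. p (Suc k) * a (m - k))"
    and b: "\<And>m. of_nat (Suc m) * b (Suc m) = (\<Sum>k\<le>m. p (Suc k) * b (m - k))"
  shows "a m = b m"
proof (induction m rule: less_induct)
  case (less m)
  show ?case
  proof (cases m)
    case 0
    then show ?thesis using assms(1) by simp
  next
    case (Suc l)
    have "(\<Sum>k\<le>l. p (Suc k) * a (l - k)) = (\<Sum>k\<le>l. p (Suc k) * b (l - k))"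
      by (intro sum.cong refl) (simp add: less Suc)
    then have "of_nat (Suc l) * a (Suc l) = of_nat (Suc l) * b (Suc l)"
      by (simp only: a b)
    then show ?thesis
      using Suc by (metis mult_left_cancel nat.distinct(1) of_nat_eq_0_iff)
  qed
qed

lemma complete_hom_0 [simp]: "complete_hom 0 n x = 1"
proof -
  have "{is :: nat list. length is = 0 \<and> sorted is \<and> set is \<subseteq> {1..n}} = {[]}"
    by auto
  then show ?thesis by (simp add: complete_hom_def)
qed

lemma complete_hom_no_variables [simp]: "complete_hom (Suc d) 0 x = 0"
proof -
  have "{is :: nat list. length is = Suc d \<and> sorted is \<and> set is \<subseteq> {1..0}} = {}"
    by auto
  then show ?thesis unfolding complete_hom_def by (simp only: sum.empty)
qed

text \<open>
  A weakly increasing index list either avoids the last variable or ends with it.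
\<close>

lemma complete_hom_Suc_Suc:
  "complete_hom (Suc d) (Suc n) x =
     complete_hom (Suc d) n x + complete_hom d (Suc n) x * x (Suc n)"
proof -
  define L where "L d n = {is :: nat list. length is = d \<and> sorted is \<and> set is \<subseteq> {1..n}}" for d n
  have fin: "finite (L d n)" for d n
    unfolding L_def by (rule finite_complete_hom_index)
  have "L (Suc d) (Suc n) = L (Suc d) n \<union> (\<lambda>is. is @ [Suc n]) ` L d (Suc n)"
  proof (intro equalityI subsetI)
    fix l assume l: "l \<in> L (Suc d) (Suc n)"
    then have "l \<noteq> []" by (auto simp: L_def)
    then obtain ks k where lk: "l = ks @ [k]" by (metis rev_exhaust)
    show "l \<in> L (Suc d) n \<union> (\<lambda>is. is @ [Suc n]) ` L d (Suc n)"
    proof (cases "k = Suc n")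
      case True
      then show ?thesis using l lk by (auto simp: L_def sorted_append)
    next
      case False
      then have "k \<le> n" using l lk by (auto simp: L_def)
      then show ?thesis using l lk by (fastforce simp: L_def sorted_append)
    qed
  qed (auto simp: L_def sorted_append subset_iff)
  moreover have "L (Suc d) n \<inter> (\<lambda>is. is @ [Suc n]) ` L d (Suc n) = {}"
    by (auto simp: L_def)
  moreover have "inj_on (\<lambda>is. is @ [Suc n]) (L d (Suc n))"
    by (auto simp: inj_on_def)
  ultimately show ?thesis
    unfolding complete_hom_def L_def[symmetric]
    by (simp add: sum.union_disjoint fin sum.reindex sum_distrib_right)
qed

text \<open>
  For the generating series \<open>H = (\<Sum>d. h d * X^d)\<close> and \<open>P = (\<Sum>k. p (k + 1) * X^k)\<close> the claim is the
  differential equation \<open>H' = P * H\<close>, the logarithmic derivative of \<open>H = (\<Prod>i. 1 / (1 - x i * X))\<close>.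
  Adding a variable \<open>y\<close> divides \<open>H\<close> by \<open>u = 1 - y * X\<close> and adds \<open>y / u\<close> to \<open>P\<close>, which is what the
  induction on the number of variables uses.
\<close>

lemma complete_hom_newton:
  fixes x :: "nat \<Rightarrow> 'a::idom"
  shows "of_nat (Suc m) * complete_hom (Suc m) n x =
    (\<Sum>k\<le>m. (\<Sum>i=1..n. x i ^ Suc k) * complete_hom (m - k) n x)"
proof -
  define H where "H n = Abs_fps (\<lambda>d. complete_hom d n x)" for n
  define P where "P n = Abs_fps (\<lambda>k. \<Sum>i=1..n. x i ^ Suc k)" for n
  have "fps_deriv (H n) = P n * H n"
  proof (induction n)
    case 0
    then show ?case
      by (intro fps_ext) (simp add: H_def P_def fps_mult_nth)
  next
    case (Suc n)
    define y where "y = x (Suc n)"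
    define u where "u = 1 - fps_const y * fps_X"
    define G where "G = Abs_fps (\<lambda>k. y ^ Suc k)"
    have Hu: "H (Suc n) = H n + fps_const y * fps_X * H (Suc n)"
    proof (rule fps_ext)
      fix d show "fps_nth (H (Suc n)) d = fps_nth (H n + fps_const y * fps_X * H (Suc n)) d"
        by (cases d)
           (simp_all add: H_def complete_hom_Suc_Suc y_def mult.assoc mult.commute)
    qed
    have Gu: "G = fps_const y + fps_const y * fps_X * G"
    proof (rule fps_ext)
      fix d show "fps_nth G d = fps_nth (fps_const y + fps_const y * fps_X * G) d"
        by (cases d) (simp_all add: G_def mult.assoc)
    qed
    have PS: "P (Suc n) = P n + G"
      by (intro fps_ext) (simp add: P_def G_def y_def)
    have dH: "fps_deriv (H (Suc n)) = fps_deriv (H n) + fps_const y * H (Suc n)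
        + fps_const y * fps_X * fps_deriv (H (Suc n))"
      by (subst Hu) (simp add: algebra_simps)
    \<comment> \<open>The constant coefficient of \<open>u\<close> is \<open>1\<close>, so \<open>u\<close> can be cancelled.\<close>
    have "u * (fps_deriv (H (Suc n)) - P (Suc n) * H (Suc n)) = 0"
    proof -
      have 1: "u * fps_deriv (H (Suc n)) = P n * H n + fps_const y * H (Suc n)"
        using dH Suc by (simp add: u_def algebra_simps)
      have 2: "u * H (Suc n) = H n"
        using Hu by (simp add: u_def algebra_simps)
      have 3: "u * G = fps_const y"
        using Gu by (simp add: u_def algebra_simps)
      have 4: "u * (P (Suc n) * H (Suc n)) = P n * (u * H (Suc n)) + (u * G) * H (Suc n)"
        by (simp add: PS algebra_simps)
      show ?thesis
        unfolding right_diff_distrib 4 1 2 3 by simp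
    qed
    moreover have "u \<noteq> 0"
    proof
      assume "u = 0"
      then have "fps_nth u 0 = 0" by simp
      then show False by (simp add: u_def)
    qed
    ultimately show ?case by simp
  qed
  then have "fps_nth (fps_deriv (H n)) m = fps_nth (P n * H n) m"
    by simp
  then show ?thesis
    by (simp add: H_def P_def fps_mult_nth atLeast0AtMost)
qed

text \<open>
  The cycle index of the symmetric group on \<open>d\<close> letters, evaluated at \<open>p 1, p 2, \<dots>\<close>.
\<close>

definition cycle_index :: "(nat \<Rightarrow> 'a::field_char_0) \<Rightarrow> nat \<Rightarrow> 'a" where
  "cycle_index p d = (\<Sum>\<pi>\<in>partitions d. prod_list (map p \<pi>) / of_nat (partition_z \<pi>))"

lemma partitions_0: "partitions 0 = {[]}"
  by (auto simp: partitions_def) (metis list.set_intros(1) list.exhaust less_irrefl)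

lemma cycle_index_0 [simp]: "cycle_index p 0 = 1"
  by (simp add: cycle_index_def partitions_0 partition_z_def)

lemma partitions_eqI:
  assumes "\<pi> \<in> partitions c" "\<sigma> \<in> partitions d" "mset \<pi> = mset \<sigma>"
  shows "\<pi> = \<sigma>"
proof -
  have "sorted (rev \<pi>)" "sorted (rev \<sigma>)"
    using assms by (auto simp: partitions_def sorted_wrt_rev)
  then have "rev \<pi> = rev \<sigma>"
    using assms(3) by (metis mset_rev properties_for_sort)
  then show ?thesis by simp
qed

lemma remove1_partition:
  assumes "\<pi> \<in> partitions d" "k \<in> set \<pi>"
  shows "remove1 k \<pi> \<in> partitions (d - k)"
proof -
  have "sorted_wrt (\<ge>) (remove1 k xs)" if "sorted_wrt (\<ge>) xs" for xs
    using that by (induction xs) (auto dest: notin_set_remove1)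
  moreover have "sum_list \<pi> = k + sum_list (remove1 k \<pi>)"
    using assms(2) by (induction \<pi>) auto
  ultimately show ?thesis
    using assms by (auto simp: partitions_def dest: notin_set_remove1)
qed

text \<open>
  Parts of multiplicity \<open>0\<close> contribute a factor \<open>1\<close>, so the product may range over the parts of a
  larger partition; this compares a partition with the one obtained by removing a part.
\<close>

lemma partition_z_superset:
  assumes "finite X" "set \<pi> \<subseteq> X"
  shows "partition_z \<pi> = (\<Prod>i\<in>X. i ^ count_list \<pi> i * fact (count_list \<pi> i))"
  unfolding partition_z_def
  using assms by (intro prod.mono_neutral_left) (auto simp: count_list_0_iff)

lemma count_list_remove1:
  "count_list (remove1 k xs) i = (if i = k then count_list xs i - 1 else count_list xs i)"
  by (induction xs) (auto simp: count_list_0_iff)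

lemma partition_z_remove1:
  assumes "k \<in> set \<pi>"
  shows "partition_z \<pi> = partition_z (remove1 k \<pi>) * (k * count_list \<pi> k)"
proof -
  define c where "c = count_list \<pi> k"
  define R where "R = (\<Prod>i\<in>set \<pi> - {k}. i ^ count_list \<pi> i * fact (count_list \<pi> i))"
  have "c \<noteq> 0" using assms by (simp add: c_def count_list_0_iff)
  then obtain b where b: "c = Suc b" using not0_implies_Suc by blast
  have "partition_z \<pi> = k ^ c * fact c * R"
    unfolding partition_z_def R_def c_def using assms by (intro prod.remove) auto
  moreover have "partition_z (remove1 k \<pi>) = k ^ (c - 1) * fact (c - 1) * R"
  proof -
    have "partition_z (remove1 k \<pi>) = (\<Prod>i\<in>set \<pi>. i ^ count_list (remove1 k \<pi>) i
        * fact (count_list (remove1 k \<pi>) i))"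
      by (intro partition_z_superset finite_set set_remove1_subset)
    also have "\<dots> = k ^ (c - 1) * fact (c - 1) *
        (\<Prod>i\<in>set \<pi> - {k}. i ^ count_list (remove1 k \<pi>) i * fact (count_list (remove1 k \<pi>) i))"
      using assms by (subst prod.remove[of _ k]) (auto simp: count_list_remove1 c_def)
    also have "(\<Prod>i\<in>set \<pi> - {k}. i ^ count_list (remove1 k \<pi>) i * fact (count_list (remove1 k \<pi>) i)) = R"
      unfolding R_def by (intro prod.cong) (auto simp: count_list_remove1)
    finally show ?thesis .
  qed
  ultimately show ?thesis
    unfolding c_def[symmetric] by (simp add: b algebra_simps)
qed

text \<open>
  Writing \<open>Suc m\<close> as the sum of \<open>k\<close> times the multiplicity of \<open>k\<close> over the distinct parts \<open>k\<close> of \<open>\<pi>\<close>,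
  each summand cancels exactly the factor by which \<open>partition_z\<close> drops when one part \<open>k\<close> is removed.
  Pairs of a partition and one of its distinct parts correspond bijectively to pairs of a part \<open>k\<close>
  and a partition of the remainder.
\<close>

lemma cycle_index_newton:
  fixes p :: "nat \<Rightarrow> 'a::field_char_0"
  shows "of_nat (Suc m) * cycle_index p (Suc m) = (\<Sum>k\<le>m. p (Suc k) * cycle_index p (m - k))"
proof -
  define f where "f \<pi> = prod_list (map p \<pi>) / of_nat (partition_z \<pi>)" for \<pi>
  have step: "of_nat (count_list \<pi> k * k) * f \<pi> = p k * f (remove1 k \<pi>)"
    if "\<pi> \<in> partitions d" "k \<in> set \<pi>" for \<pi> k d
  proof -
    have "mset \<pi> = mset (k # remove1 k \<pi>)"
      using that by simp
    then have "prod_list (map p \<pi>) = p k * prod_list (map p (remove1 k \<pi>))"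
      by (metis list.simps(9) mset_map prod_list.Cons prod_mset_prod_list)
    moreover have "count_list \<pi> k * k \<noteq> 0"
      using that by (auto simp: partitions_def count_list_0_iff)
    ultimately show ?thesis
      unfolding f_def partition_z_remove1[OF that(2)]
      by (simp add: field_simps del: mult_eq_0_iff)
  qed
  have sumk: "of_nat (Suc m) * f \<pi> = (\<Sum>k\<in>set \<pi>. p k * f (remove1 k \<pi>))"
    if "\<pi> \<in> partitions (Suc m)" for \<pi>
  proof -
    have "Suc m = (\<Sum>k\<in>set \<pi>. count_list \<pi> k * k)"
      using that sum_list_map_eq_sum_count[of "\<lambda>k. k" \<pi>] by (simp add: partitions_def)
    then have "of_nat (Suc m) * f \<pi> = (\<Sum>k\<in>set \<pi>. of_nat (count_list \<pi> k * k) * f \<pi>)"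
      by (simp only: of_nat_sum sum_distrib_right)
    then show ?thesis using step[OF that] by simp
  qed
  have "of_nat (Suc m) * cycle_index p (Suc m) =
      (\<Sum>(\<pi>, k)\<in>(SIGMA \<pi>:partitions (Suc m). set \<pi>). p k * f (remove1 k \<pi>))"
    unfolding cycle_index_def f_def[symmetric] sum_distrib_left
    by (subst sum.Sigma[symmetric]) (auto simp: finite_partitions sumk simp del: of_nat_Suc intro!: sum.cong)
  also have "\<dots> = (\<Sum>(k, \<sigma>)\<in>(SIGMA k:{..m}. partitions (m - k)). p (Suc k) * f \<sigma>)"
  proof (rule sum.reindex_bij_witness[where
        i = "\<lambda>(k, \<sigma>). (rev (sort (Suc k # \<sigma>)), Suc k)" and
        j = "\<lambda>(\<pi>, k). (k - 1, remove1 k \<pi>)"])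
    fix a assume "a \<in> (SIGMA \<pi>:partitions (Suc m). set \<pi>)"
    then obtain \<pi> k where a: "a = (\<pi>, k)" "\<pi> \<in> partitions (Suc m)" "k \<in> set \<pi>" by auto
    then have k: "0 < k" by (auto simp: partitions_def)
    have ms: "mset \<pi> = mset (k # remove1 k \<pi>)" using a by simp
    have sl: "sum_list \<pi> = k + sum_list (remove1 k \<pi>)"
      by (metis ms sum_list.Cons sum_mset_sum_list)
    have "sorted (rev \<pi>)" using a by (simp add: partitions_def sorted_wrt_rev)
    then have "sort (k # remove1 k \<pi>) = rev \<pi>"
      by (intro properties_for_sort) (simp_all add: a)
    then show "(case case a of (\<pi>, k) \<Rightarrow> (k - 1, remove1 k \<pi>) of
        (k, \<sigma>) \<Rightarrow> (rev (sort (Suc k # \<sigma>)), Suc k)) = a"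
      using a k by simp
    have "k \<le> Suc m" using a sl by (simp add: partitions_def)
    then show "(case a of (\<pi>, k) \<Rightarrow> (k - 1, remove1 k \<pi>)) \<in> (SIGMA k:{..m}. partitions (m - k))"
      using remove1_partition[OF a(2,3)] a k by (cases k) auto
    show "(case case a of (\<pi>, k) \<Rightarrow> (k - 1, remove1 k \<pi>) of (k, \<sigma>) \<Rightarrow> p (Suc k) * f \<sigma>) =
        (case a of (\<pi>, k) \<Rightarrow> p k * f (remove1 k \<pi>))"
      using a k by simp
  next
    fix b assume "b \<in> (SIGMA k:{..m}. partitions (m - k))"
    then obtain k \<sigma> where b: "b = (k, \<sigma>)" "k \<le> m" "\<sigma> \<in> partitions (m - k)" by auto
    define \<pi> where "\<pi> = rev (sort (Suc k # \<sigma>))"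
    have ms: "mset \<pi> = mset (Suc k # \<sigma>)" by (simp add: \<pi>_def)
    have "sum_list \<pi> = sum_list (Suc k # \<sigma>)" by (metis ms sum_mset_sum_list)
    moreover have "set \<pi> = insert (Suc k) (set \<sigma>)"
      by (metis ms set_mset_mset list.simps(15))
    moreover have "sorted_wrt (\<ge>) \<pi>"
      unfolding \<pi>_def sorted_wrt_rev by (metis rev_rev_ident sorted_sort)
    ultimately have \<pi>: "\<pi> \<in> partitions (Suc m)" "Suc k \<in> set \<pi>"
      using b by (auto simp: partitions_def)
    then show "(case b of (k, \<sigma>) \<Rightarrow> (rev (sort (Suc k # \<sigma>)), Suc k)) \<in>
        (SIGMA \<pi>:partitions (Suc m). set \<pi>)"
      using b by (auto simp: \<pi>_def)
    have "remove1 (Suc k) \<pi> = \<sigma>"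
      by (rule partitions_eqI[OF remove1_partition[OF \<pi>] b(3)]) (simp add: ms)
    then show "(case case b of (k, \<sigma>) \<Rightarrow> (rev (sort (Suc k # \<sigma>)), Suc k) of
        (\<pi>, k) \<Rightarrow> (k - 1, remove1 k \<pi>)) = b"
      using b by (simp add: \<pi>_def)
  qed
  also have "\<dots> = (\<Sum>k\<le>m. p (Suc k) * cycle_index p (m - k))"
    by (subst sum.Sigma[symmetric])
       (auto simp: finite_partitions cycle_index_def f_def sum_distrib_left)
  finally show ?thesis .
qed

section \<open>Gaussian integration by parts\<close>

definition std_gaussian :: "real measure" where
  "std_gaussian = density lborel std_normal_density"

abbreviation gaussian_on :: "'i set \<Rightarrow> ('i \<Rightarrow> real) measure" where
  "gaussian_on I \<equiv> Pi\<^sub>M I (\<lambda>_. std_gaussian)"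

lemma sets_std_gaussian [measurable_cong, simp]: "sets std_gaussian = sets borel"
  by (simp add: std_gaussian_def)

lemma prob_space_std_gaussian: "prob_space std_gaussian"
  unfolding std_gaussian_def by (rule prob_space_normal_density) simp

lemma product_prob_space_std_gaussian: "product_prob_space (\<lambda>_. std_gaussian)"
  by (intro product_prob_spaceI prob_space_std_gaussian)

lemma prob_space_gaussian_on: "prob_space (gaussian_on I)"
  by (intro prob_space_PiM prob_space_std_gaussian)

lemma integrable_std_gaussian_power: "integrable std_gaussian (\<lambda>x. x ^ m)"
  unfolding std_gaussian_def
  by (subst integrable_real_density)
     (auto intro: integrable_std_normal_moment)

text \<open>
  Constant multiples of products of these powers bound all polynomials in several variables.
\<close>

lemma integrable_std_gaussian_dominating: "integrable std_gaussian (\<lambda>x. (1 + \<bar>x\<bar>) ^ m)"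
proof -
  have "integrable std_gaussian (\<lambda>x. \<Sum>k\<le>m. of_nat (m choose k) * \<bar>x\<bar> ^ k)"
    unfolding std_gaussian_def
    by (intro Bochner_Integration.integrable_sum integrable_mult_right, subst integrable_real_density)
       (auto intro: integrable_std_normal_moment_abs)
  also have "(\<lambda>x. \<Sum>k\<le>m. of_nat (m choose k) * \<bar>x\<bar> ^ k) = (\<lambda>x. (\<bar>x\<bar> + 1 :: real) ^ m)"
    by (simp add: binomial_ring)
  finally show ?thesis by (simp add: add.commute)
qed

lemma std_gaussian_moment_Suc_Suc:
  "(\<integral>x. x ^ Suc (Suc m) \<partial>std_gaussian) = Suc m * (\<integral>x. x ^ m \<partial>std_gaussian)"
proof -
  have eq: "(\<integral>x. x ^ k \<partial>std_gaussian) = (\<integral>x. std_normal_density x * x ^ k \<partial>lborel)" for k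
    unfolding std_gaussian_def by (subst integral_real_density) auto
  show ?thesis
  proof (cases "even m")
    case True
    then obtain k where k: "m = 2 * k" by blast
    then have k2: "Suc (Suc m) = 2 * Suc k" by simp
    have e: "2 * Suc k = Suc (Suc (2 * k))" by simp
    have num: "(fact (2 * Suc k) :: real) = 2 * real (Suc k) * (Suc m * fact (2 * k))"
      unfolding e fact_Suc k by (simp add: distrib_right)
    have den: "(2 ^ Suc k * fact (Suc k) :: real) = 2 * real (Suc k) * (2 ^ k * fact k)"
      unfolding fact_Suc power_Suc by (simp only: mult_ac)
    show ?thesis
      unfolding eq k2 unfolding k integral_std_normal_moment_even
      unfolding num den unfolding k[symmetric]
      by (subst mult_divide_mult_cancel_left) (simp, simp add: distrib_right)
  next
    case False
    then obtain k where k: "m = 2 * k + 1" using oddE by blast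
    then have k2: "Suc (Suc m) = 2 * Suc k + 1" by simp
    show ?thesis
      unfolding eq k2 unfolding k integral_std_normal_moment_odd by simp
  qed
qed

lemma std_gaussian_moment_1: "(\<integral>x. x \<partial>std_gaussian) = 0"
  using integral_std_normal_moment_odd[of 0]
  unfolding std_gaussian_def by (subst integral_real_density) auto

lemma integrable_std_gaussian_poly:
  fixes p :: "complex poly"
  shows "integrable std_gaussian (\<lambda>x. poly p (of_real x))"
  unfolding poly_altdef of_real_power[symmetric]
  by (intro Bochner_Integration.integrable_sum integrable_mult_right integrable_of_real integrable_std_gaussian_power)

text \<open>
  By linearity it is enough to treat monomials, where the statement is the recursion for the
  Gaussian moments.
\<close>

lemma std_gaussian_integration_by_parts:
  fixes p :: "complex poly"
  shows "(\<integral>x. of_real x * poly p (of_real x) \<partial>std_gaussian) =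
    (\<integral>x. poly (pderiv p) (of_real x) \<partial>std_gaussian)" (is "?Q p")
proof -
  have add: "?Q (p + q)" if "?Q p" "?Q q" for p q
    using that integrable_std_gaussian_poly[of "pCons 0 p"] integrable_std_gaussian_poly[of "pCons 0 q"]
    by (simp add: distrib_left pderiv_add integrable_std_gaussian_poly)
  have monom: "?Q (monom c m)" for c m
  proof -
    have "(\<integral>x. of_real x * poly (monom c m) (of_real x) \<partial>std_gaussian) =
        (\<integral>x. c * complex_of_real (x ^ Suc m) \<partial>std_gaussian)"
      by (simp add: poly_monom mult_ac)
    also have "\<dots> = c * of_real (\<integral>x. x ^ Suc m \<partial>std_gaussian)"
      by (simp only: integral_mult_right_zero integral_complex_of_real)
    also have "\<dots> = (\<integral>x. poly (pderiv (monom c m)) (of_real x) \<partial>std_gaussian)"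
    proof (cases m)
      case 0
      then show ?thesis by (simp add: std_gaussian_moment_1 pderiv_monom)
    next
      case (Suc k)
      have "(\<integral>x. poly (pderiv (monom c m)) (of_real x) \<partial>std_gaussian) =
        (\<integral>x. (of_nat m * c) * complex_of_real (x ^ k) \<partial>std_gaussian)"
        by (simp add: pderiv_monom poly_monom Suc del: of_nat_Suc)
      also have "\<dots> = of_nat m * c * of_real (\<integral>x. x ^ k \<partial>std_gaussian)"
        by (simp only: integral_mult_right_zero integral_complex_of_real)
      finally show ?thesis
        unfolding Suc std_gaussian_moment_Suc_Suc by simp
    qed
    finally show ?thesis .
  qed
  have "?Q (\<Sum>i\<in>A. monom (coeff p i) i)" if "finite A" for A
    using that
  proof (induction A)
    case (insert i A)
    then show ?case using add[OF monom insert.IH] by simp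
  qed simp
  from this[of "{..degree p}"] show ?thesis
    unfolding poly_as_sum_of_monoms by blast
qed

text \<open>
  Complex polynomial functions of the real coordinates \<open>x i\<close> with \<open>i\<close> in \<open>I\<close>, generated inductively
  because the proofs use only their closure properties and their growth.
\<close>

inductive poly_fun :: "'i set \<Rightarrow> (('i \<Rightarrow> real) \<Rightarrow> complex) \<Rightarrow> bool" for I where
  poly_fun_const: "poly_fun I (\<lambda>_. c)"
| poly_fun_coord: "i \<in> I \<Longrightarrow> poly_fun I (\<lambda>x. of_real (x i))"
| poly_fun_add: "poly_fun I F \<Longrightarrow> poly_fun I G \<Longrightarrow> poly_fun I (\<lambda>x. F x + G x)"
| poly_fun_mult: "poly_fun I F \<Longrightarrow> poly_fun I G \<Longrightarrow> poly_fun I (\<lambda>x. F x * G x)"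

lemma poly_fun_sum:
  "(\<And>a. a \<in> A \<Longrightarrow> poly_fun I (F a)) \<Longrightarrow> poly_fun I (\<lambda>x. \<Sum>a\<in>A. F a x)"
  by (induction A rule: infinite_finite_induct) (auto intro: poly_fun.intros)

lemma poly_fun_power: "poly_fun I F \<Longrightarrow> poly_fun I (\<lambda>x. F x ^ m)"
  by (induction m) (auto intro: poly_fun.intros)

lemma poly_fun_cnj: "poly_fun I F \<Longrightarrow> poly_fun I (\<lambda>x. cnj (F x))"
  by (induction rule: poly_fun.induct) (auto intro: poly_fun.intros)

lemma poly_fun_measurable:
  "poly_fun I F \<Longrightarrow> F \<in> borel_measurable (gaussian_on I)"
proof (induction rule: poly_fun.induct)
  case (poly_fun_coord i)
  then have "(\<lambda>x. x i) \<in> gaussian_on I \<rightarrow>\<^sub>M std_gaussian"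
    by (rule measurable_component_singleton)
  then have "(\<lambda>x. x i) \<in> borel_measurable (gaussian_on I)"
    by (simp cong: measurable_cong_sets)
  then show ?case by (rule measurable_compose[OF _ borel_measurable_of_real])
qed simp_all

text \<open>
  The bound is a product of functions of single coordinates, whose integral over a product measure
  factorises.
\<close>

lemma poly_fun_growth:
  assumes "poly_fun I F" "finite I"
  shows "\<exists>C K. 0 \<le> C \<and> (\<forall>x. cmod (F x) \<le> C * (\<Prod>i\<in>I. (1 + \<bar>x i\<bar>) ^ K))"
proof -
  define W where "W K x = (\<Prod>i\<in>I. (1 + \<bar>x i\<bar>) ^ K)" for K and x :: "'a \<Rightarrow> real"
  have W1: "1 \<le> W K x" for K x
    unfolding W_def by (intro prod_ge_1) simp
  have Wmono: "W K x \<le> W L x" if "K \<le> L" for K L x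
    unfolding W_def using that by (intro prod_mono conjI power_increasing) auto
  have Wadd: "W (K + L) x = W K x * W L x" for K L x
    unfolding W_def by (simp add: power_add prod.distrib)
  have "\<exists>C K. 0 \<le> C \<and> (\<forall>x. cmod (F x) \<le> C * W K x)"
    using assms(1)
  proof induction
    case (poly_fun_const c)
    then show ?case using W1 by (intro exI[of _ "cmod c"] exI[of _ 0]) (simp add: W_def)
  next
    case (poly_fun_coord i)
    have "\<bar>x i\<bar> \<le> W 1 x" for x
    proof -
      have "1 + \<bar>x i\<bar> \<le> (1 + \<bar>x i\<bar>) * (\<Prod>j\<in>I - {i}. 1 + \<bar>x j\<bar>)"
        using mult_left_mono[OF prod_ge_1[of "I - {i}" "\<lambda>j. 1 + \<bar>x j\<bar>"], of "1 + \<bar>x i\<bar>"] by simp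
      also have "\<dots> = W 1 x"
        unfolding W_def using poly_fun_coord assms(2) by (simp add: prod.remove)
      finally show ?thesis by simp
    qed
    then show ?case by (intro exI[of _ 1] exI[of _ 1]) simp
  next
    case (poly_fun_add F G)
    then obtain C K D L where
      F: "0 \<le> C" "\<And>x. cmod (F x) \<le> C * W K x" and G: "0 \<le> D" "\<And>x. cmod (G x) \<le> D * W L x"
      by blast
    have "cmod (F x + G x) \<le> (C + D) * W (max K L) x" for x
    proof -
      have "cmod (F x) \<le> C * W (max K L) x"
        using F(2)[of x] mult_left_mono[OF Wmono F(1), of K "max K L" x] by simp
      moreover have "cmod (G x) \<le> D * W (max K L) x"
        using G(2)[of x] mult_left_mono[OF Wmono G(1), of L "max K L" x] by simp
      ultimately show ?thesis
        using norm_triangle_ineq[of "F x" "G x"] by (simp add: distrib_right)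
    qed
    then show ?case using F(1) G(1) by (meson add_nonneg_nonneg)
  next
    case (poly_fun_mult F G)
    then obtain C K D L where
      F: "0 \<le> C" "\<And>x. cmod (F x) \<le> C * W K x" and G: "0 \<le> D" "\<And>x. cmod (G x) \<le> D * W L x"
      by blast
    have "cmod (F x * G x) \<le> (C * D) * W (K + L) x" for x
    proof -
      have "cmod (F x) * cmod (G x) \<le> (C * W K x) * (D * W L x)"
        using F G by (intro mult_mono) (auto intro: order_trans[OF norm_ge_zero])
      then show ?thesis by (simp add: norm_mult Wadd mult_ac)
    qed
    then show ?case using F(1) G(1) by (meson mult_nonneg_nonneg)
  qed
  then show ?thesis unfolding W_def .
qed

lemma poly_fun_integrable:
  assumes "poly_fun I F" "finite I"
  shows "integrable (gaussian_on I) F"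
proof -
  interpret product_prob_space "\<lambda>_. std_gaussian" I by (rule product_prob_space_std_gaussian)
  obtain C K where CK: "0 \<le> C" "\<And>x. cmod (F x) \<le> C * (\<Prod>i\<in>I. (1 + \<bar>x i\<bar>) ^ K)"
    using poly_fun_growth[OF assms] by blast
  show ?thesis
  proof (rule Bochner_Integration.integrable_bound)
    show "integrable (gaussian_on I) (\<lambda>x. C * (\<Prod>i\<in>I. (1 + \<bar>x i\<bar>) ^ K))"
      using assms(2)
      by (intro integrable_mult_right product_integrable_prod integrable_std_gaussian_dominating)
    show "F \<in> borel_measurable (gaussian_on I)"
      by (rule poly_fun_measurable[OF assms(1)])
    show "AE x in gaussian_on I. norm (F x) \<le> norm (C * (\<Prod>i\<in>I. (1 + \<bar>x i\<bar>) ^ K))"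
      using CK by (auto intro: order_trans[OF _ abs_ge_self])
  qed
qed

text \<open>
  Partial derivatives are described by the formal derivative of a univariate polynomial on each line
  parallel to the \<open>i\<close>-th axis, which is the form in which the one-dimensional integration by parts
  applies.
\<close>

definition has_partial :: "'i set \<Rightarrow> 'i \<Rightarrow> (('i \<Rightarrow> real) \<Rightarrow> complex) \<Rightarrow> (('i \<Rightarrow> real) \<Rightarrow> complex) \<Rightarrow> bool" where
  "has_partial I i F G \<longleftrightarrow> poly_fun I F \<and> poly_fun I G \<and>
     (\<forall>x. \<exists>p. \<forall>y. F (x(i := y)) = poly p (of_real y) \<and> G (x(i := y)) = poly (pderiv p) (of_real y))"

lemma has_partial_const: "has_partial I i (\<lambda>_. c) (\<lambda>_. 0)"
  unfolding has_partial_def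
  by (intro conjI allI poly_fun.intros exI[of _ "[:c:]"]) (simp_all add: pderiv_pCons)

lemma has_partial_coord:
  assumes "j \<in> I"
  shows "has_partial I i (\<lambda>x. of_real (x j)) (\<lambda>_. if j = i then 1 else 0)"
proof -
  have "\<exists>p. \<forall>y. of_real ((x(i := y)) j) = poly p (complex_of_real y) \<and>
      (if j = i then 1 else 0) = poly (pderiv p) (of_real y)" for x :: "'a \<Rightarrow> real"
    by (rule exI[of _ "if j = i then [:0, 1:] else [:of_real (x j):]"]) (simp add: pderiv_pCons)
  then show ?thesis
    unfolding has_partial_def using assms by (auto intro: poly_fun.intros)
qed

lemma has_partial_add:
  assumes "has_partial I i F F'" "has_partial I i G G'"
  shows "has_partial I i (\<lambda>x. F x + G x) (\<lambda>x. F' x + G' x)"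
proof -
  have "\<exists>p. \<forall>y. F (x(i := y)) + G (x(i := y)) = poly p (of_real y) \<and>
      F' (x(i := y)) + G' (x(i := y)) = poly (pderiv p) (of_real y)" for x
  proof -
    obtain p q where "\<forall>y. F (x(i := y)) = poly p (of_real y) \<and> F' (x(i := y)) = poly (pderiv p) (of_real y)"
      "\<forall>y. G (x(i := y)) = poly q (of_real y) \<and> G' (x(i := y)) = poly (pderiv q) (of_real y)"
      using assms unfolding has_partial_def by metis
    then show ?thesis by (intro exI[of _ "p + q"]) (simp add: pderiv_add)
  qed
  then show ?thesis
    using assms unfolding has_partial_def by (auto intro: poly_fun.intros)
qed

lemma has_partial_mult:
  assumes "has_partial I i F F'" "has_partial I i G G'"
  shows "has_partial I i (\<lambda>x. F x * G x) (\<lambda>x. F x * G' x + F' x * G x)"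
proof -
  have "\<exists>p. \<forall>y. F (x(i := y)) * G (x(i := y)) = poly p (of_real y) \<and>
      F (x(i := y)) * G' (x(i := y)) + F' (x(i := y)) * G (x(i := y)) =
        poly (pderiv p) (of_real y)" for x
  proof -
    obtain p q where "\<forall>y. F (x(i := y)) = poly p (of_real y) \<and> F' (x(i := y)) = poly (pderiv p) (of_real y)"
      "\<forall>y. G (x(i := y)) = poly q (of_real y) \<and> G' (x(i := y)) = poly (pderiv q) (of_real y)"
      using assms unfolding has_partial_def by metis
    then show ?thesis by (intro exI[of _ "p * q"]) (simp add: pderiv_mult mult_ac)
  qed
  then show ?thesis
    using assms unfolding has_partial_def by (auto intro: poly_fun.intros)
qed

text \<open>
  Fubini reduces the claim to the integral over the \<open>i\<close>-th coordinate.
\<close>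

lemma gaussian_integration_by_parts:
  assumes "finite I" "i \<in> I" and FG: "has_partial I i F G"
  shows "(\<integral>x. of_real (x i) * F x \<partial>gaussian_on I) = (\<integral>x. G x \<partial>gaussian_on I)"
proof -
  interpret product_prob_space "\<lambda>_. std_gaussian" I by (rule product_prob_space_std_gaussian)
  define J where "J = I - {i}"
  have J: "finite J" "i \<notin> J" "insert i J = I" using assms by (auto simp: J_def)
  have "poly_fun I (\<lambda>x. of_real (x i) * F x)" "poly_fun I G"
    using FG assms(2) by (auto simp: has_partial_def intro: poly_fun.intros)
  then have int: "integrable (gaussian_on (insert i J)) (\<lambda>x. of_real (x i) * F x)"
    "integrable (gaussian_on (insert i J)) G"
    unfolding J by (auto intro: poly_fun_integrable assms(1))
  have "(\<integral>y. of_real ((x(i := y)) i) * F (x(i := y)) \<partial>std_gaussian) =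
      (\<integral>y. G (x(i := y)) \<partial>std_gaussian)" for x
  proof -
    obtain p where "\<And>y. F (x(i := y)) = poly p (of_real y)"
      "\<And>y. G (x(i := y)) = poly (pderiv p) (of_real y)"
      using FG unfolding has_partial_def by metis
    then show ?thesis by (simp add: std_gaussian_integration_by_parts)
  qed
  then show ?thesis
    using product_integral_insert[OF J(1,2) int(1)] product_integral_insert[OF J(1,2) int(2)]
    by (simp add: J(3))
qed

section \<open>Complex Gaussian vectors\<close>

text \<open>
  The real and imaginary parts of the \<open>j\<close>-th coordinate are indexed by \<open>(j, False)\<close> and \<open>(j, True)\<close>.
\<close>

abbreviation complex_gaussian :: "nat \<Rightarrow> (nat \<times> bool \<Rightarrow> real) measure" where
  "complex_gaussian n \<equiv> gaussian_on ({..<n} \<times> UNIV)"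

abbreviation poly_fun_C :: "nat \<Rightarrow> ((nat \<times> bool \<Rightarrow> real) \<Rightarrow> complex) \<Rightarrow> bool" where
  "poly_fun_C n \<equiv> poly_fun ({..<n} \<times> UNIV)"

text \<open>
  With this scaling the complex coordinates satisfy \<open>E[cnj (z j) * z j] = 1\<close>.
\<close>

definition inv_sqrt2 :: complex where
  "inv_sqrt2 = of_real (1 / sqrt 2)"

lemma inv_sqrt2_square: "inv_sqrt2 * inv_sqrt2 = 1 / 2"
proof -
  have "(1 / sqrt 2) * (1 / sqrt 2) = (1 / 2 :: real)" by simp
  then show ?thesis
    unfolding inv_sqrt2_def by (metis of_real_1 of_real_divide of_real_mult of_real_numeral)
qed

definition zcoord :: "(nat \<times> bool \<Rightarrow> real) \<Rightarrow> nat \<Rightarrow> complex" where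
  "zcoord x j = inv_sqrt2 * (of_real (x (j, False)) + \<i> * of_real (x (j, True)))"

lemma cnj_zcoord:
  "cnj (zcoord x j) = inv_sqrt2 * (of_real (x (j, False)) + (- \<i>) * of_real (x (j, True)))"
  by (simp add: zcoord_def inv_sqrt2_def)

lemma poly_fun_zcoord: "j < n \<Longrightarrow> poly_fun_C n (\<lambda>x. zcoord x j)"
  unfolding zcoord_def by (intro poly_fun.intros) auto

lemma complex_gaussian_integrable: "poly_fun_C n F \<Longrightarrow> integrable (complex_gaussian n) F"
  by (intro poly_fun_integrable) auto

text \<open>
  \<open>G\<close> is the Wirtinger derivative of \<open>F\<close> in \<open>z j\<close>, with \<open>z j\<close> and \<open>cnj (z j)\<close> treated as independent
  variables.  For \<open>z j = (x + \<i> y) / sqrt 2\<close> it is \<open>(\<partial>F/\<partial>x - \<i> \<partial>F/\<partial>y) / sqrt 2\<close>.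
\<close>

definition has_wirtinger ::
  "nat \<Rightarrow> nat \<Rightarrow> ((nat \<times> bool \<Rightarrow> real) \<Rightarrow> complex) \<Rightarrow> ((nat \<times> bool \<Rightarrow> real) \<Rightarrow> complex) \<Rightarrow> bool" where
  "has_wirtinger n j F G \<longleftrightarrow>
     (\<exists>Fr Fi. has_partial ({..<n} \<times> UNIV) (j, False) F Fr \<and> has_partial ({..<n} \<times> UNIV) (j, True) F Fi \<and>
        G = (\<lambda>x. inv_sqrt2 * (Fr x - \<i> * Fi x)))"

lemma has_wirtingerI:
  assumes "has_partial ({..<n} \<times> UNIV) (j, False) F Fr" "has_partial ({..<n} \<times> UNIV) (j, True) F Fi"
    and "\<And>x. G x = inv_sqrt2 * (Fr x - \<i> * Fi x)"
  shows "has_wirtinger n j F G"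
  using assms unfolding has_wirtinger_def by blast

lemma has_wirtinger_const: "has_wirtinger n j (\<lambda>_. c) (\<lambda>_. 0)"
  by (rule has_wirtingerI[OF has_partial_const has_partial_const]) simp

lemma has_wirtinger_add:
  assumes "has_wirtinger n j F F'" "has_wirtinger n j G G'"
  shows "has_wirtinger n j (\<lambda>x. F x + G x) (\<lambda>x. F' x + G' x)"
proof -
  obtain Fr Fi Gr Gi where
    "has_partial ({..<n} \<times> UNIV) (j, False) F Fr" "has_partial ({..<n} \<times> UNIV) (j, True) F Fi"
    "has_partial ({..<n} \<times> UNIV) (j, False) G Gr" "has_partial ({..<n} \<times> UNIV) (j, True) G Gi"
    "F' = (\<lambda>x. inv_sqrt2 * (Fr x - \<i> * Fi x))"
    "G' = (\<lambda>x. inv_sqrt2 * (Gr x - \<i> * Gi x))"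
    using assms unfolding has_wirtinger_def by auto
  then show ?thesis
    by (intro has_wirtingerI[OF has_partial_add has_partial_add]) (auto simp: algebra_simps)
qed

lemma has_wirtinger_mult:
  assumes "has_wirtinger n j F F'" "has_wirtinger n j G G'"
  shows "has_wirtinger n j (\<lambda>x. F x * G x) (\<lambda>x. F x * G' x + F' x * G x)"
proof -
  obtain Fr Fi Gr Gi where
    "has_partial ({..<n} \<times> UNIV) (j, False) F Fr" "has_partial ({..<n} \<times> UNIV) (j, True) F Fi"
    "has_partial ({..<n} \<times> UNIV) (j, False) G Gr" "has_partial ({..<n} \<times> UNIV) (j, True) G Gi"
    "F' = (\<lambda>x. inv_sqrt2 * (Fr x - \<i> * Fi x))"
    "G' = (\<lambda>x. inv_sqrt2 * (Gr x - \<i> * Gi x))"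
    using assms unfolding has_wirtinger_def by auto
  then show ?thesis
    by (intro has_wirtingerI[OF has_partial_mult has_partial_mult]) (auto simp: algebra_simps)
qed

lemma has_wirtinger_sum:
  "(\<And>a. a \<in> A \<Longrightarrow> has_wirtinger n j (F a) (F' a)) \<Longrightarrow>
    has_wirtinger n j (\<lambda>x. \<Sum>a\<in>A. F a x) (\<lambda>x. \<Sum>a\<in>A. F' a x)"
  by (induction A rule: infinite_finite_induct)
     (auto intro: has_wirtinger_const has_wirtinger_add)

lemma has_wirtinger_power:
  assumes "has_wirtinger n j F F'"
  shows "has_wirtinger n j (\<lambda>x. F x ^ m) (\<lambda>x. of_nat m * F x ^ (m - 1) * F' x)"
proof (induction m)
  case 0
  then show ?case using has_wirtinger_const[of n j 1] by simp
next
  case (Suc m)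
  have "F x * (of_nat m * F x ^ (m - 1) * F' x) + F' x * F x ^ m =
      of_nat (Suc m) * F x ^ (Suc m - 1) * F' x" for x
    by (cases m) (simp_all add: algebra_simps)
  then show ?case
    using has_wirtinger_mult[OF assms Suc] by simp
qed

lemma has_wirtinger_zcoord:
  assumes "k < n"
  shows "has_wirtinger n j (\<lambda>x. zcoord x k) (\<lambda>_. if k = j then 1 else 0)"
  unfolding zcoord_def
proof -
  have part: "has_partial ({..<n} \<times> UNIV) (j, b)
     (\<lambda>x. inv_sqrt2 * (of_real (x (k, False)) + \<i> * of_real (x (k, True))))
     (\<lambda>x. inv_sqrt2 * (((if (k, False) = (j, b) then 1 else 0)
        + (\<i> * (if (k, True) = (j, b) then 1 else 0) + 0 * of_real (x (k, True)))))
        + 0 * (of_real (x (k, False)) + \<i> * of_real (x (k, True))))" for b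
    using assms
    by (intro has_partial_mult has_partial_add has_partial_const has_partial_coord) auto
  show "has_wirtinger n j
     (\<lambda>x. inv_sqrt2 * (of_real (x (k, False)) + \<i> * of_real (x (k, True))))
     (\<lambda>_. if k = j then 1 else 0)"
    by (rule has_wirtingerI[OF part part])
       (use inv_sqrt2_square in \<open>auto simp: algebra_simps\<close>)
qed

lemma has_wirtinger_cnj_zcoord:
  assumes "k < n"
  shows "has_wirtinger n j (\<lambda>x. cnj (zcoord x k)) (\<lambda>_. 0)"
  unfolding cnj_zcoord
proof -
  have part: "has_partial ({..<n} \<times> UNIV) (j, b)
     (\<lambda>x. inv_sqrt2 * (of_real (x (k, False)) + (- \<i>) * of_real (x (k, True))))
     (\<lambda>x. inv_sqrt2 * (((if (k, False) = (j, b) then 1 else 0)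
        + ((- \<i>) * (if (k, True) = (j, b) then 1 else 0) + 0 * of_real (x (k, True)))))
        + 0 * (of_real (x (k, False)) + (- \<i>) * of_real (x (k, True))))" for b
    using assms
    by (intro has_partial_mult has_partial_add has_partial_const has_partial_coord) auto
  show "has_wirtinger n j
     (\<lambda>x. inv_sqrt2 * (of_real (x (k, False)) + (- \<i>) * of_real (x (k, True))))
     (\<lambda>_. 0)"
    by (rule has_wirtingerI[OF part part])
       (use inv_sqrt2_square in \<open>auto simp: algebra_simps\<close>)
qed

text \<open>
  Both sides are the same combination of the real integrations by parts in \<open>(j, False)\<close> and
  \<open>(j, True)\<close>: conjugating \<open>z j\<close> produces the coefficients of the Wirtinger derivative.
\<close>

lemma complex_gaussian_integration_by_parts:
  assumes "j < n" and FG: "has_wirtinger n j F G"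
  shows "(\<integral>x. cnj (zcoord x j) * F x \<partial>complex_gaussian n) = (\<integral>x. G x \<partial>complex_gaussian n)"
proof -
  obtain Fr Fi where
    p: "has_partial ({..<n} \<times> UNIV) (j, False) F Fr" "has_partial ({..<n} \<times> UNIV) (j, True) F Fi" and
    G: "G = (\<lambda>x. inv_sqrt2 * (Fr x - \<i> * Fi x))"
    using FG unfolding has_wirtinger_def by auto
  have pf: "poly_fun_C n F" "poly_fun_C n Fr" "poly_fun_C n Fi"
    using p by (auto simp: has_partial_def)
  have mem: "(j, b) \<in> {..<n} \<times> (UNIV :: bool set)" for b
    using assms(1) by simp
  note int = complex_gaussian_integrable[OF poly_fun_mult[OF poly_fun_coord[OF mem] pf(1)]]
    complex_gaussian_integrable[OF pf(2)] complex_gaussian_integrable[OF pf(3)]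
  have "(\<integral>x. cnj (zcoord x j) * F x \<partial>complex_gaussian n) =
     (\<integral>x. inv_sqrt2 * (of_real (x (j, False)) * F x - \<i> * (of_real (x (j, True)) * F x)) \<partial>complex_gaussian n)"
    by (simp add: cnj_zcoord algebra_simps)
  also have "\<dots> = inv_sqrt2 *
      ((\<integral>x. of_real (x (j, False)) * F x \<partial>complex_gaussian n) -
       \<i> * (\<integral>x. of_real (x (j, True)) * F x \<partial>complex_gaussian n))"
    using int by simp
  also have "\<dots> = inv_sqrt2 *
      ((\<integral>x. Fr x \<partial>complex_gaussian n) - \<i> * (\<integral>x. Fi x \<partial>complex_gaussian n))"
    using gaussian_integration_by_parts[OF _ mem p(1)] gaussian_integration_by_parts[OF _ mem p(2)]
    by simp
  also have "\<dots> = (\<integral>x. G x \<partial>complex_gaussian n)"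
    unfolding G using int by simp
  finally show ?thesis .
qed

section \<open>Moments of Gaussian quadratic forms\<close>

definition quad_form :: "complex mat \<Rightarrow> (nat \<times> bool \<Rightarrow> real) \<Rightarrow> complex" where
  "quad_form A x = (\<Sum>i<dim_row A. cnj (zcoord x i) * (\<Sum>j<dim_col A. A $$ (i, j) * zcoord x j))"

lemma quad_form_carrier:
  "A \<in> carrier_mat n n \<Longrightarrow>
    quad_form A x = (\<Sum>i<n. cnj (zcoord x i) * (\<Sum>j<n. A $$ (i, j) * zcoord x j))"
  by (simp add: quad_form_def)

lemma has_wirtinger_row:
  assumes "j < n"
  shows "has_wirtinger n j (\<lambda>x. \<Sum>l<n. A $$ (i, l) * zcoord x l) (\<lambda>_. A $$ (i, j))"
proof -
  have "has_wirtinger n j (\<lambda>x. \<Sum>l<n. A $$ (i, l) * zcoord x l)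
      (\<lambda>x. \<Sum>l<n. A $$ (i, l) * (if l = j then 1 else 0) + 0 * zcoord x l)"
    by (intro has_wirtinger_sum has_wirtinger_mult has_wirtinger_const has_wirtinger_zcoord) auto
  then show ?thesis using assms by (simp add: mult_delta_right)
qed

lemma has_wirtinger_quad_form:
  assumes "A \<in> carrier_mat n n" "j < n"
  shows "has_wirtinger n j (quad_form A) (\<lambda>x. \<Sum>i<n. cnj (zcoord x i) * A $$ (i, j))"
proof -
  have "has_wirtinger n j (\<lambda>x. \<Sum>i<n. cnj (zcoord x i) * (\<Sum>l<n. A $$ (i, l) * zcoord x l))
      (\<lambda>x. \<Sum>i<n. cnj (zcoord x i) * A $$ (i, j) + 0 * (\<Sum>l<n. A $$ (i, l) * zcoord x l))"
    using assms(2)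
    by (intro has_wirtinger_sum has_wirtinger_mult has_wirtinger_cnj_zcoord has_wirtinger_row) auto
  then show ?thesis using quad_form_carrier[OF assms(1), abs_def] by simp
qed

lemma poly_fun_quad_form:
  assumes "A \<in> carrier_mat n n" shows "poly_fun_C n (quad_form A)"
  unfolding quad_form_carrier[OF assms, abs_def]
  by (intro poly_fun_sum poly_fun_mult poly_fun_cnj poly_fun_zcoord poly_fun_const) auto

lemma mult_mat_index:
  assumes "A \<in> carrier_mat n n" "B \<in> carrier_mat n n" "i < n" "j < n"
  shows "(A * B) $$ (i, j) = (\<Sum>k<n. A $$ (i, k) * B $$ (k, j))"
  using assms by (simp add: scalar_prod_def row_def col_def atLeast0LessThan)

text \<open>
  Write \<open>quad_form K\<close> as the sum of \<open>cnj (z i) * (K z) i\<close> and integrate each term by parts.  The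
  derivative of \<open>(K z) i\<close> contributes the diagonal entry of \<open>K\<close>; the derivative of \<open>quad_form A\<close> is
  \<open>(z* A) i\<close>, and the sum of \<open>(z* A) i * (K z) i\<close> is the form of \<open>A * K\<close>.
\<close>

lemma gaussian_quad_form_recursion:
  assumes K: "K \<in> carrier_mat n n" and A: "A \<in> carrier_mat n n"
  shows "(\<integral>x. quad_form K x * quad_form A x ^ m \<partial>complex_gaussian n) =
    mat_trace K * (\<integral>x. quad_form A x ^ m \<partial>complex_gaussian n) +
    of_nat m * (\<integral>x. quad_form (A * K) x * quad_form A x ^ (m - 1) \<partial>complex_gaussian n)"
proof -
  define row where "row i x = (\<Sum>j<n. K $$ (i, j) * zcoord x j)" for i x
  define col where "col i x = (\<Sum>j<n. cnj (zcoord x j) * A $$ (j, i))" for i x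
  have AK: "A * K \<in> carrier_mat n n" using A K by simp
  have pf: "poly_fun_C n (row i)" "poly_fun_C n (col i)" for i
    unfolding row_def col_def
    by (intro poly_fun_sum poly_fun_mult poly_fun_cnj poly_fun_zcoord poly_fun_const; auto)+
  note pfs = poly_fun_sum poly_fun_mult poly_fun_cnj poly_fun_zcoord poly_fun_const poly_fun_power
    poly_fun_quad_form pf A K AK
  have "(\<integral>x. quad_form K x * quad_form A x ^ m \<partial>complex_gaussian n) =
      (\<integral>x. (\<Sum>i<n. cnj (zcoord x i) * (row i x * quad_form A x ^ m)) \<partial>complex_gaussian n)"
    by (simp add: quad_form_carrier[OF K] row_def sum_distrib_right mult.assoc)
  also have "\<dots> = (\<Sum>i<n. \<integral>x. cnj (zcoord x i) * (row i x * quad_form A x ^ m) \<partial>complex_gaussian n)"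
    by (intro Bochner_Integration.integral_sum complex_gaussian_integrable pfs) auto
  also have "\<dots> = (\<Sum>i<n. \<integral>x. (row i x * (of_nat m * quad_form A x ^ (m - 1) * col i x)
      + K $$ (i, i) * quad_form A x ^ m) \<partial>complex_gaussian n)"
    unfolding row_def col_def
    by (intro sum.cong refl complex_gaussian_integration_by_parts has_wirtinger_mult
        has_wirtinger_power has_wirtinger_quad_form has_wirtinger_row A) auto
  also have "\<dots> = (\<integral>x. (\<Sum>i<n. (row i x * (of_nat m * quad_form A x ^ (m - 1) * col i x)
      + K $$ (i, i) * quad_form A x ^ m)) \<partial>complex_gaussian n)"
    by (intro Bochner_Integration.integral_sum[symmetric] complex_gaussian_integrable pfs poly_fun_add)
  also have "\<dots> = (\<integral>x. mat_trace K * quad_form A x ^ m +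
      of_nat m * (quad_form (A * K) x * quad_form A x ^ (m - 1)) \<partial>complex_gaussian n)"
  proof (rule Bochner_Integration.integral_cong[OF refl])
    fix x
    have "quad_form (A * K) x = (\<Sum>j<n. \<Sum>l<n. \<Sum>i<n. cnj (zcoord x j) * A $$ (j, i) * (K $$ (i, l) * zcoord x l))"
      unfolding quad_form_carrier[OF AK]
      by (intro sum.cong refl)
         (simp add: mult_mat_index[OF A K] sum_distrib_left sum_distrib_right mult_ac)
    also have "\<dots> = (\<Sum>j<n. \<Sum>i<n. \<Sum>l<n. cnj (zcoord x j) * A $$ (j, i) * (K $$ (i, l) * zcoord x l))"
      by (intro sum.cong refl sum.swap)
    also have "\<dots> = (\<Sum>i<n. \<Sum>j<n. \<Sum>l<n. cnj (zcoord x j) * A $$ (j, i) * (K $$ (i, l) * zcoord x l))"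
      by (rule sum.swap)
    also have "\<dots> = (\<Sum>i<n. col i x * row i x)"
      by (simp add: col_def row_def sum_product)
    finally have "(\<Sum>i<n. col i x * row i x) = quad_form (A * K) x" ..
    moreover have "(\<Sum>i<n. row i x * (of_nat m * quad_form A x ^ (m - 1) * col i x) + K $$ (i, i) * quad_form A x ^ m)
        = of_nat m * ((\<Sum>i<n. col i x * row i x) * quad_form A x ^ (m - 1)) + (\<Sum>i<n. K $$ (i, i)) * quad_form A x ^ m"
      by (simp add: sum.distrib sum_distrib_left sum_distrib_right mult_ac)
    ultimately show "(\<Sum>i<n. row i x * (of_nat m * quad_form A x ^ (m - 1) * col i x) + K $$ (i, i) * quad_form A x ^ m)
        = mat_trace K * quad_form A x ^ m + of_nat m * (quad_form (A * K) x * quad_form A x ^ (m - 1))"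
      using K by (simp add: mat_trace_def)
  qed
  also have "\<dots> = mat_trace K * (\<integral>x. quad_form A x ^ m \<partial>complex_gaussian n) +
    of_nat m * (\<integral>x. quad_form (A * K) x * quad_form A x ^ (m - 1) \<partial>complex_gaussian n)"
  proof -
    have "integrable (complex_gaussian n) (\<lambda>x. quad_form A x ^ m)"
      "integrable (complex_gaussian n) (\<lambda>x. quad_form (A * K) x * quad_form A x ^ (m - 1))"
      by (intro complex_gaussian_integrable pfs)+
    then show ?thesis by simp
  qed
  finally show ?thesis .
qed

definition gaussian_moment :: "complex mat \<Rightarrow> nat \<Rightarrow> complex" where
  "gaussian_moment A m =
     (\<integral>x. quad_form A x ^ m \<partial>complex_gaussian (dim_row A)) / fact m"

lemma gaussian_moment_0 [simp]: "gaussian_moment A 0 = 1"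
proof -
  interpret prob_space "complex_gaussian (dim_row A)" by (rule prob_space_gaussian_on)
  show ?thesis by (simp add: gaussian_moment_def prob_space)
qed

lemma pow_mat_Suc_left:
  assumes "(A :: 'a::semiring_1 mat) \<in> carrier_mat n n"
  shows "A ^\<^sub>m Suc k = A * A ^\<^sub>m k"
proof (induction k)
  case 0
  then show ?case using assms by simp
next
  case (Suc k)
  have "A ^\<^sub>m Suc (Suc k) = (A * A ^\<^sub>m k) * A"
    using Suc by simp
  also have "\<dots> = A * A ^\<^sub>m Suc k"
    using assms by (simp add: assoc_mult_mat[of _ n n _ n _ n])
  finally show ?case .
qed

text \<open>
  The recursion for \<open>K = A^(l + 1)\<close> replaces \<open>l\<close> by \<open>l + 1\<close> while lowering the power of \<open>quad_form A\<close> by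
  one; unrolling it from \<open>l = 0\<close> gives the sum.
\<close>

lemma gaussian_moment_newton:
  assumes A: "A \<in> carrier_mat n n"
  shows "of_nat (Suc m) * gaussian_moment A (Suc m) =
    (\<Sum>k\<le>m. mat_trace (A ^\<^sub>m Suc k) * gaussian_moment A (m - k))"
proof -
  have dim: "dim_row A = n" using A by simp
  \<comment> \<open>The shift \<open>l\<close> is generalised because each step of the recursion raises it.\<close>
  have "(\<integral>x. quad_form (A ^\<^sub>m Suc l) x * quad_form A x ^ m \<partial>complex_gaussian n) / fact m =
      (\<Sum>k\<le>m. mat_trace (A ^\<^sub>m Suc (l + k)) * gaussian_moment A (m - k))" for l
  proof (induction m arbitrary: l)
    case 0
    have "A ^\<^sub>m Suc l \<in> carrier_mat n n" by (rule pow_carrier_mat[OF A])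
    from gaussian_quad_form_recursion[OF this A, of 0] show ?case
      using prob_space.prob_space[OF prob_space_gaussian_on, of "{..<n} \<times> (UNIV :: bool set)"]
      by (simp del: pow_mat.simps)
  next
    case (Suc m)
    have 1: "A ^\<^sub>m Suc l \<in> carrier_mat n n" by (rule pow_carrier_mat[OF A])
    have 2: "A * A ^\<^sub>m Suc l = A ^\<^sub>m Suc (Suc l)"
      by (rule pow_mat_Suc_left[OF A, symmetric])
    have "(\<integral>x. quad_form (A ^\<^sub>m Suc l) x * quad_form A x ^ Suc m \<partial>complex_gaussian n) / fact (Suc m) =
       mat_trace (A ^\<^sub>m Suc l) * gaussian_moment A (Suc m) +
       (of_nat (Suc m) / fact (Suc m)) * (\<integral>x. quad_form (A ^\<^sub>m Suc (Suc l)) x * quad_form A x ^ m \<partial>complex_gaussian n)"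
      unfolding gaussian_quad_form_recursion[OF 1 A, of "Suc m"] 2 gaussian_moment_def dim
      by (simp add: add_divide_distrib del: pow_mat.simps of_nat_Suc fact_Suc)
    also have "of_nat (Suc m) / fact (Suc m) = (1 / fact m :: complex)"
      unfolding fact_Suc by (simp del: of_nat_Suc)
    also have "1 / fact m * (\<integral>x. quad_form (A ^\<^sub>m Suc (Suc l)) x * quad_form A x ^ m \<partial>complex_gaussian n)
        = (\<Sum>k\<le>m. mat_trace (A ^\<^sub>m Suc (Suc l + k)) * gaussian_moment A (m - k))"
      using Suc.IH[of "Suc l"] by simp
    finally show ?case
      unfolding sum.atMost_Suc_shift by (simp del: pow_mat.simps)
  qed
  from this[of 0] have "(\<integral>x. quad_form A x ^ Suc m \<partial>complex_gaussian n) / fact m =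
      (\<Sum>k\<le>m. mat_trace (A ^\<^sub>m Suc k) * gaussian_moment A (m - k))"
    using A by simp
  moreover have "of_nat (Suc m) * gaussian_moment A (Suc m) =
      (\<integral>x. quad_form A x ^ Suc m \<partial>complex_gaussian n) / fact m"
    unfolding gaussian_moment_def dim fact_Suc by (simp del: of_nat_Suc power_Suc)
  ultimately show ?thesis by simp
qed

text \<open>
  Both sides start at \<open>1\<close> and obey Newton's recursion with the traces of powers as power sums.
\<close>

lemma gaussian_moment_cycle_index:
  assumes "A \<in> carrier_mat n n"
  shows "gaussian_moment A d = cycle_index (\<lambda>k. mat_trace (A ^\<^sub>m k)) d"
  by (rule newton_recursion_unique[where p = "\<lambda>k. mat_trace (A ^\<^sub>m k)"])
     (simp_all only: gaussian_moment_0 cycle_index_0 gaussian_moment_newton[OF assms] cycle_index_newton)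

section \<open>Expanding traces of powers into words\<close>

lemma mat_adjoint_dim [simp]:
  "dim_row (mat_adjoint A) = dim_col A" "dim_col (mat_adjoint A) = dim_row A"
  by (simp_all add: mat_adjoint_def)

lemma mat_adjoint_carrier [simp]: "A \<in> carrier_mat n n \<Longrightarrow> mat_adjoint A \<in> carrier_mat n n"
  by (intro carrier_matI) (simp_all only: mat_adjoint_dim carrier_matD)

lemma mat_adjoint_mult:
  fixes A B :: "complex mat"
  assumes "A \<in> carrier_mat n n" "B \<in> carrier_mat n n"
  shows "mat_adjoint (A * B) = mat_adjoint B * mat_adjoint A"
proof (rule eq_matI)
  fix i j assume "i < dim_row (mat_adjoint B * mat_adjoint A)" "j < dim_col (mat_adjoint B * mat_adjoint A)"
  then have ij: "i < n" "j < n" using assms by simp_all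
  have "mat_adjoint (A * B) $$ (i, j) = (\<Sum>k<n. cnj (A $$ (j, k)) * cnj (B $$ (k, i)))"
    using assms ij by (simp add: mat_adjoint_index mult_mat_index[OF assms] del: index_mult_mat(1))
  also have "\<dots> = (mat_adjoint B * mat_adjoint A) $$ (i, j)"
    using assms ij
    by (subst mult_mat_index[of _ n]) (simp_all add: mat_adjoint_index mult.commute)
  finally show "mat_adjoint (A * B) $$ (i, j) = (mat_adjoint B * mat_adjoint A) $$ (i, j)" .
qed (use assms in simp_all)

lemma mat_adjoint_power:
  fixes A :: "complex mat"
  assumes A: "A \<in> carrier_mat n n"
  shows "mat_adjoint (A ^\<^sub>m k) = mat_adjoint A ^\<^sub>m k"
proof (induction k)
  case 0
  show ?case
    using A by (intro eq_matI) (auto simp: mat_adjoint_index)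
next
  case (Suc k)
  have "mat_adjoint (A ^\<^sub>m Suc k) = mat_adjoint A * mat_adjoint (A ^\<^sub>m k)"
    using A by (simp add: mat_adjoint_mult[OF pow_carrier_mat[OF A] A])
  also have "\<dots> = mat_adjoint A ^\<^sub>m Suc k"
    using A by (simp only: Suc pow_mat_Suc_left[OF mat_adjoint_carrier[OF A]])
  finally show ?case .
qed

lemma mat_trace_adjoint:
  fixes A :: "complex mat"
  assumes "A \<in> carrier_mat n n"
  shows "mat_trace (mat_adjoint A) = cnj (mat_trace A)"
  using assms by (simp add: mat_trace_def mat_adjoint_index)

text \<open>
  Two parameters instead of one make the symmetry under the adjoint visible: taking adjoints
  exchanges and conjugates them.
\<close>

definition adjoint_pencil :: "complex mat \<Rightarrow> complex \<Rightarrow> complex \<Rightarrow> complex mat" where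
  "adjoint_pencil A s t = s \<cdot>\<^sub>m A + t \<cdot>\<^sub>m mat_adjoint A"

lemma adjoint_pencil_carrier [simp]:
  "A \<in> carrier_mat n n \<Longrightarrow> adjoint_pencil A s t \<in> carrier_mat n n"
  by (simp add: adjoint_pencil_def)

lemma mat_adjoint_pencil:
  assumes "A \<in> carrier_mat n n"
  shows "mat_adjoint (adjoint_pencil A s t) = adjoint_pencil A (cnj t) (cnj s)"
  using assms by (intro eq_matI) (auto simp: adjoint_pencil_def mat_adjoint_index)

lemma sum_Pow_Un_disjoint:
  assumes "finite A" "finite B" "A \<inter> B = {}"
  shows "(\<Sum>S\<in>Pow (A \<union> B). f S) = (\<Sum>S\<in>Pow A. \<Sum>T\<in>Pow B. f (S \<union> T))"
proof -
  have "(\<Sum>S\<in>Pow (A \<union> B). f S) = (\<Sum>(S, T)\<in>Pow A \<times> Pow B. f (S \<union> T))"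
    by (rule sum.reindex_bij_witness[where i = "\<lambda>(S, T). S \<union> T" and j = "\<lambda>S. (S \<inter> A, S \<inter> B)"])
       (use assms(3) in \<open>auto simp: Int_Un_distrib[symmetric] Int_absorb2\<close>)
  then show ?thesis by (simp add: sum.cartesian_product)
qed

text \<open>
  The weight of the word that has \<open>A*\<close> in the positions \<open>S\<close> and \<open>A\<close> in the other positions of \<open>U\<close>, when
  \<open>s A + t A*\<close> is expanded.  As a product over positions it is multiplicative over disjoint blocks.
\<close>

definition choice_weight :: "'a::comm_monoid_mult \<Rightarrow> 'a \<Rightarrow> nat set \<Rightarrow> nat set \<Rightarrow> 'a" where
  "choice_weight s t U S = (\<Prod>p\<in>U. if p \<in> S then t else s)"

lemma choice_weight_card:
  assumes "finite U" "S \<subseteq> U"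
  shows "choice_weight s t U S = s ^ (card U - card S) * t ^ card S"
proof -
  have "U \<inter> {p. p \<in> S} = S" "U \<inter> - {p. p \<in> S} = U - S" using assms by auto
  then show ?thesis
    using assms
    by (simp add: choice_weight_def prod.If_cases card_Diff_subset finite_subset mult.commute)
qed

lemma choice_weight_Un:
  assumes "finite U" "finite V" "U \<inter> V = {}" "S \<subseteq> U" "T \<subseteq> V"
  shows "choice_weight s t (U \<union> V) (S \<union> T) = choice_weight s t U S * choice_weight s t V T"
proof -
  have "choice_weight s t U (S \<union> T) = choice_weight s t U S"
    "choice_weight s t V (S \<union> T) = choice_weight s t V T"
    unfolding choice_weight_def using assms by (auto intro!: prod.cong)
  then show ?thesis
    using assms(1-3) by (simp add: choice_weight_def prod.union_disjoint)
qed

lemma adjoint_word_cong: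
  "S \<inter> set ps = T \<inter> set ps \<Longrightarrow> adjoint_word A S ps = adjoint_word A T ps"
  unfolding adjoint_word_def by (rule foldr_cong) auto

lemma adjoint_word_carrier:
  assumes "A \<in> carrier_mat n n"
  shows "adjoint_word A S ps \<in> carrier_mat n n"
  by (induction ps) (use assms in \<open>auto simp: adjoint_word_def\<close>)

text \<open>
  Distributivity, one factor at a time: each position of the word contributes either \<open>s A\<close> or \<open>t A*\<close>.
\<close>

lemma adjoint_pencil_power_index:
  assumes A: "A \<in> carrier_mat n n" and "distinct ps" "i < n" "j < n"
  shows "(adjoint_pencil A s t ^\<^sub>m length ps) $$ (i, j) =
    (\<Sum>S\<in>Pow (set ps). choice_weight s t (set ps) S * adjoint_word A S ps $$ (i, j))"
  using assms(2-)
proof (induction ps arbitrary: i)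
  case Nil
  then show ?case
    using A carrier_matD(1)[OF adjoint_pencil_carrier[OF A, of s t]]
    by (simp add: choice_weight_def adjoint_word_def)
next
  case (Cons p ps)
  let ?M = "adjoint_pencil A s t"
  let ?w = "choice_weight s t (set ps)"
  have M: "?M \<in> carrier_mat n n" using A by simp
  have p: "p \<notin> set ps" using Cons.prems by simp
  have word: "adjoint_word A S (p # ps) $$ (i, j) =
      (\<Sum>k<n. (if p \<in> S then mat_adjoint A else A) $$ (i, k) * adjoint_word A (S - {p}) ps $$ (k, j))" for S
  proof -
    have "adjoint_word A S (p # ps) = (if p \<in> S then mat_adjoint A else A) * adjoint_word A S ps"
      by (simp add: adjoint_word_def)
    also have "adjoint_word A S ps = adjoint_word A (S - {p}) ps"
      using p by (intro adjoint_word_cong) auto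
    finally show ?thesis
      using A Cons.prems by (simp add: mult_mat_index[OF _ adjoint_word_carrier[OF A]] del: index_mult_mat(1))
  qed
  have "(?M ^\<^sub>m length (p # ps)) $$ (i, j) = (\<Sum>k<n. ?M $$ (i, k) * (?M ^\<^sub>m length ps) $$ (k, j))"
    using Cons.prems pow_mat_Suc_left[OF M, of "length ps"]
    by (simp add: mult_mat_index[OF M pow_carrier_mat[OF M]] del: index_mult_mat(1) pow_mat.simps)
  also have "\<dots> = (\<Sum>k<n. (s * A $$ (i, k) + t * mat_adjoint A $$ (i, k)) *
      (\<Sum>S\<in>Pow (set ps). ?w S * adjoint_word A S ps $$ (k, j)))"
    using Cons A by (intro sum.cong refl) (simp add: adjoint_pencil_def)
  also have "\<dots> = (\<Sum>S\<in>Pow (set ps). s * ?w S * (\<Sum>k<n. A $$ (i, k) * adjoint_word A S ps $$ (k, j)) +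
      t * ?w S * (\<Sum>k<n. mat_adjoint A $$ (i, k) * adjoint_word A S ps $$ (k, j)))"
    unfolding sum_distrib_left sum.distrib[symmetric]
    by (subst sum.swap) (simp add: algebra_simps)
  also have "\<dots> = (\<Sum>S\<in>Pow (set ps). \<Sum>T\<in>Pow {p}. choice_weight s t (set ps \<union> {p}) (S \<union> T) *
      adjoint_word A (S \<union> T) (p # ps) $$ (i, j))"
  proof (rule sum.cong[OF refl])
    fix S assume "S \<in> Pow (set ps)"
    then have S: "S \<subseteq> set ps" "p \<notin> S" using p by auto
    have P: "Pow {p} = {{}, {p}}" by auto
    have w: "choice_weight s t (set ps \<union> {p}) (S \<union> T) = ?w S * choice_weight s t {p} T"
      if "T \<subseteq> {p}" for T
      using S p that by (intro choice_weight_Un) auto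
    show "s * ?w S * (\<Sum>k<n. A $$ (i, k) * adjoint_word A S ps $$ (k, j)) +
      t * ?w S * (\<Sum>k<n. mat_adjoint A $$ (i, k) * adjoint_word A S ps $$ (k, j)) =
      (\<Sum>T\<in>Pow {p}. choice_weight s t (set ps \<union> {p}) (S \<union> T) *
        adjoint_word A (S \<union> T) (p # ps) $$ (i, j))"
      (is "_ = ?R")
    proof -
      have c: "choice_weight s t {p} {} = s" "choice_weight s t {p} {p} = t"
        by (simp_all add: choice_weight_def)
      have "?R = choice_weight s t (set ps \<union> {p}) (S \<union> {}) * adjoint_word A (S \<union> {}) (p # ps) $$ (i, j) +
          choice_weight s t (set ps \<union> {p}) (S \<union> {p}) * adjoint_word A (S \<union> {p}) (p # ps) $$ (i, j)"
        unfolding P by simp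
      also have "\<dots> = ?w S * s * adjoint_word A (S \<union> {}) (p # ps) $$ (i, j) +
          ?w S * t * adjoint_word A (S \<union> {p}) (p # ps) $$ (i, j)"
        by (simp only: w[OF empty_subsetI] w[OF subset_refl] c)
      finally show ?thesis
        using S by (simp add: word mult_ac)
    qed
  qed
  also have "\<dots> = (\<Sum>S\<in>Pow (set (p # ps)). choice_weight s t (set (p # ps)) S *
      adjoint_word A S (p # ps) $$ (i, j))"
    using p by (subst sum_Pow_Un_disjoint[symmetric]) auto
  finally show ?case .
qed

lemma mat_trace_adjoint_pencil_power:
  assumes A: "A \<in> carrier_mat n n" and "distinct ps"
  shows "mat_trace (adjoint_pencil A s t ^\<^sub>m length ps) =
    (\<Sum>S\<in>Pow (set ps). choice_weight s t (set ps) S * mat_trace (adjoint_word A S ps))"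
proof -
  have dim: "dim_row (adjoint_pencil A s t) = n" "dim_row (adjoint_word A S ps) = n" for S
    using adjoint_word_carrier[OF A, of S ps] adjoint_pencil_carrier[OF A, of s t] by auto
  have "mat_trace (adjoint_pencil A s t ^\<^sub>m length ps) =
      (\<Sum>i<n. \<Sum>S\<in>Pow (set ps). choice_weight s t (set ps) S * adjoint_word A S ps $$ (i, i))"
    unfolding mat_trace_def
    by (simp add: dim adjoint_pencil_power_index[OF A assms(2)])
  also have "\<dots> = (\<Sum>S\<in>Pow (set ps). choice_weight s t (set ps) S * mat_trace (adjoint_word A S ps))"
    by (subst sum.swap) (simp add: mat_trace_def dim sum_distrib_left)
  finally show ?thesis .
qed

text \<open>
  The blocks occupy disjoint sets of positions, so choosing a subset of each block is the same as
  choosing one subset of their union.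
\<close>

lemma prod_mat_trace_adjoint_pencil_power:
  assumes A: "A \<in> carrier_mat n n" and "distinct (concat pss)"
  shows "(\<Prod>ps\<leftarrow>pss. mat_trace (adjoint_pencil A s t ^\<^sub>m length ps)) =
    (\<Sum>S\<in>Pow (set (concat pss)). choice_weight s t (set (concat pss)) S *
       (\<Prod>ps\<leftarrow>pss. mat_trace (adjoint_word A S ps)))"
  using assms(2)
proof (induction pss)
  case Nil
  then show ?case by (simp add: choice_weight_def)
next
  case (Cons ps pss)
  let ?U = "set ps" and ?V = "set (concat pss)"
  have disj: "?U \<inter> ?V = {}" and dist: "distinct ps" "distinct (concat pss)"
    using Cons.prems by auto
  have "(\<Prod>qs\<leftarrow>ps # pss. mat_trace (adjoint_pencil A s t ^\<^sub>m length qs)) =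
      (\<Sum>S\<in>Pow ?U. \<Sum>T\<in>Pow ?V. (choice_weight s t ?U S * mat_trace (adjoint_word A S ps)) *
        (choice_weight s t ?V T * (\<Prod>qs\<leftarrow>pss. mat_trace (adjoint_word A T qs))))"
    by (simp add: mat_trace_adjoint_pencil_power[OF A dist(1)] Cons.IH[OF dist(2)] sum_product
        del: set_concat)
  also have "\<dots> = (\<Sum>S\<in>Pow ?U. \<Sum>T\<in>Pow ?V. choice_weight s t (?U \<union> ?V) (S \<union> T) *
        (\<Prod>qs\<leftarrow>ps # pss. mat_trace (adjoint_word A (S \<union> T) qs)))"
  proof (intro sum.cong refl)
    fix S T assume ST: "S \<in> Pow ?U" "T \<in> Pow ?V"
    have 1: "choice_weight s t (?U \<union> ?V) (S \<union> T) = choice_weight s t ?U S * choice_weight s t ?V T"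
      using ST disj by (intro choice_weight_Un) (auto simp del: set_concat)
    have 2: "adjoint_word A (S \<union> T) ps = adjoint_word A S ps"
      using ST disj by (intro adjoint_word_cong) blast
    have 3: "map (\<lambda>qs. mat_trace (adjoint_word A (S \<union> T) qs)) pss =
        map (\<lambda>qs. mat_trace (adjoint_word A T qs)) pss"
    proof (rule map_cong[OF refl])
      fix qs assume "qs \<in> set pss"
      then have "set qs \<subseteq> ?V" by auto
      then have "(S \<union> T) \<inter> set qs = T \<inter> set qs"
        using ST disj by blast
      then show "mat_trace (adjoint_word A (S \<union> T) qs) = mat_trace (adjoint_word A T qs)"
        by (simp only: adjoint_word_cong[of "S \<union> T" qs T])
    qed
    show "(choice_weight s t ?U S * mat_trace (adjoint_word A S ps)) *
        (choice_weight s t ?V T * (\<Prod>qs\<leftarrow>pss. mat_trace (adjoint_word A T qs))) =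
        choice_weight s t (?U \<union> ?V) (S \<union> T) *
        (\<Prod>qs\<leftarrow>ps # pss. mat_trace (adjoint_word A (S \<union> T) qs))"
      by (simp only: 1 2 3 list.map prod_list.Cons mult_ac)
  qed
  also have "\<dots> = (\<Sum>S\<in>Pow (set (concat (ps # pss))). choice_weight s t (set (concat (ps # pss))) S *
       (\<Prod>qs\<leftarrow>ps # pss. mat_trace (adjoint_word A S qs)))"
    using sum_Pow_Un_disjoint[OF _ _ disj, symmetric] by (simp del: set_concat)
  finally show ?case .
qed

lemma concat_block_positions:
  "m \<le> length \<pi> \<Longrightarrow> concat (map (block_positions \<pi>) [0..<m]) = [0..<sum_list (take m \<pi>)]"
proof (induction m)
  case (Suc m)
  then have "sum_list (take (Suc m) \<pi>) = sum_list (take m \<pi>) + \<pi> ! m"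
    by (simp add: take_Suc_conv_app_nth)
  then show ?case
    using Suc upt_add_eq_append[of 0 "sum_list (take m \<pi>)" "\<pi> ! m"]
    by (simp add: block_positions_def)
qed simp

lemma length_block_positions: "k < length \<pi> \<Longrightarrow> length (block_positions \<pi> k) = \<pi> ! k"
  by (simp add: block_positions_def take_Suc_conv_app_nth)

text \<open>
  For \<open>j\<close> equal to half the number of positions this is \<open>trace_poly\<close> before normalisation.  The
  values for all \<open>j\<close> are needed because they are the coefficients of one polynomial.
\<close>

definition adjoint_count_sum :: "nat list \<Rightarrow> complex mat \<Rightarrow> nat \<Rightarrow> complex" where
  "adjoint_count_sum \<pi> A j = (\<Sum>S | S \<subseteq> {..<sum_list \<pi>} \<and> card S = j.
     \<Prod>k<length \<pi>. mat_trace (adjoint_word A S (block_positions \<pi> k)))"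

lemma trace_poly_adjoint_count_sum:
  "trace_poly \<pi> A = adjoint_count_sum \<pi> A (sum_list \<pi> div 2) /
     of_nat (sum_list \<pi> choose (sum_list \<pi> div 2))"
  by (simp add: trace_poly_def adjoint_count_sum_def Let_def)

lemma prod_trace_pencil_expansion:
  assumes A: "A \<in> carrier_mat n n" and d: "sum_list \<pi> = d"
  shows "(\<Prod>k\<leftarrow>\<pi>. mat_trace (adjoint_pencil A s t ^\<^sub>m k)) =
    (\<Sum>j\<le>d. s ^ (d - j) * t ^ j * adjoint_count_sum \<pi> A j)"
proof -
  define F where "F S = (\<Prod>k<length \<pi>. mat_trace (adjoint_word A S (block_positions \<pi> k)))" for S
  define pss where "pss = map (block_positions \<pi>) [0..<length \<pi>]"
  have upt: "concat pss = [0..<d]"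
    unfolding pss_def using concat_block_positions[of "length \<pi>" \<pi>] d by simp
  have F: "(\<Prod>ps\<leftarrow>pss. mat_trace (adjoint_word A S ps)) = F S" for S
    unfolding F_def pss_def
    by (simp add: prod.distinct_set_conv_list comp_def flip: atLeast0LessThan set_upt)
  have "map (\<lambda>k. mat_trace (adjoint_pencil A s t ^\<^sub>m k)) \<pi> =
      map (\<lambda>ps. mat_trace (adjoint_pencil A s t ^\<^sub>m length ps)) pss"
    by (rule nth_equalityI) (simp_all add: pss_def length_block_positions)
  then have "(\<Prod>k\<leftarrow>\<pi>. mat_trace (adjoint_pencil A s t ^\<^sub>m k)) =
      (\<Sum>S\<in>Pow (set (concat pss)). choice_weight s t (set (concat pss)) S *
       (\<Prod>ps\<leftarrow>pss. mat_trace (adjoint_word A S ps)))"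
    using prod_mat_trace_adjoint_pencil_power[OF A, of pss s t] upt by simp
  also have "\<dots> = (\<Sum>S\<in>Pow {..<d}. s ^ (d - card S) * t ^ card S * F S)"
    unfolding F upt by (intro sum.cong) (auto simp: choice_weight_card atLeast0LessThan)
  also have "\<dots> = (\<Sum>j\<le>d. \<Sum>S\<in>{S \<in> Pow {..<d}. card S = j}. s ^ (d - card S) * t ^ card S * F S)"
  proof (rule sum.group[symmetric])
    show "card ` Pow {..<d} \<subseteq> {..d}"
      using card_mono[of "{..<d}"] by fastforce
  qed auto
  also have "\<dots> = (\<Sum>j\<le>d. s ^ (d - j) * t ^ j * adjoint_count_sum \<pi> A j)"
    by (intro sum.cong refl) (simp add: adjoint_count_sum_def F_def[symmetric] d sum_distrib_left)
  finally show ?thesis .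
qed

text \<open>
  The trace of an adjoint is the conjugate trace, and the adjoint of \<open>A + t A*\<close> is
  \<open>cnj t A + A*\<close>; hence conjugation reverses the order of the coefficients of the expansion.
\<close>

lemma adjoint_count_sum_cnj:
  assumes A: "A \<in> carrier_mat n n" and j: "j \<le> sum_list \<pi>"
  shows "cnj (adjoint_count_sum \<pi> A j) = adjoint_count_sum \<pi> A (sum_list \<pi> - j)"
proof -
  define d where "d = sum_list \<pi>"
  have sym: "cnj (\<Prod>k\<leftarrow>\<pi>. mat_trace (adjoint_pencil A s t ^\<^sub>m k)) =
      (\<Prod>k\<leftarrow>\<pi>. mat_trace (adjoint_pencil A (cnj t) (cnj s) ^\<^sub>m k))" for s t
  proof -
    have M: "adjoint_pencil A s t \<in> carrier_mat n n" using A by simp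
    have "cnj (mat_trace (adjoint_pencil A s t ^\<^sub>m k)) =
        mat_trace (adjoint_pencil A (cnj t) (cnj s) ^\<^sub>m k)" for k
      using mat_trace_adjoint[OF pow_carrier_mat[OF M, of k]]
      by (simp add: mat_adjoint_power[OF M] mat_adjoint_pencil[OF A])
    then show ?thesis by (induction \<pi>) simp_all
  qed
  have "\<forall>u. (\<Sum>j\<le>d. cnj (adjoint_count_sum \<pi> A j) * u ^ j) =
      (\<Sum>j\<le>d. adjoint_count_sum \<pi> A (d - j) * u ^ j)"
  proof
    fix u
    \<comment> \<open>Both sides are values of the expansion, at \<open>(1, cnj u)\<close> conjugated and at \<open>(u, 1)\<close>.\<close>
    have "(\<Sum>j\<le>d. cnj (adjoint_count_sum \<pi> A j) * u ^ j) =
        cnj (\<Prod>k\<leftarrow>\<pi>. mat_trace (adjoint_pencil A 1 (cnj u) ^\<^sub>m k))"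
      unfolding prod_trace_pencil_expansion[OF A d_def[symmetric]] by (simp add: mult.commute)
    also have "\<dots> = (\<Sum>j\<le>d. u ^ (d - j) * adjoint_count_sum \<pi> A j)"
      unfolding sym unfolding prod_trace_pencil_expansion[OF A d_def[symmetric]] by simp
    also have "\<dots> = (\<Sum>j\<le>d. adjoint_count_sum \<pi> A (d - j) * u ^ j)"
      by (rule sum.reindex_bij_witness[of _ "\<lambda>j. d - j" "\<lambda>j. d - j"]) (auto simp: mult.commute)
    finally show "(\<Sum>j\<le>d. cnj (adjoint_count_sum \<pi> A j) * u ^ j) =
      (\<Sum>j\<le>d. adjoint_count_sum \<pi> A (d - j) * u ^ j)" .
  qed
  then show ?thesis
    using j unfolding polyfun_eq_coeffs d_def by blast
qed

text \<open>
  The middle coefficient is its own mirror image under conjugation.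
\<close>

lemma trace_poly_real:
  assumes "A \<in> carrier_mat n n" "even (sum_list \<pi>)"
  shows "trace_poly \<pi> A \<in> \<real>"
proof -
  have "sum_list \<pi> - sum_list \<pi> div 2 = sum_list \<pi> div 2" using assms(2) by presburger
  then have "cnj (trace_poly \<pi> A) = trace_poly \<pi> A"
    using adjoint_count_sum_cnj[OF assms(1), of "sum_list \<pi> div 2" \<pi>]
    by (simp add: trace_poly_adjoint_count_sum)
  then show ?thesis using Reals_cnj_iff by blast
qed

section \<open>The triple norm as a Gaussian absolute moment\<close>

lemma quad_form_add:
  assumes "A \<in> carrier_mat n n" "B \<in> carrier_mat n n"
  shows "quad_form (A + B) x = quad_form A x + quad_form B x"
proof -
  have AB: "A + B \<in> carrier_mat n n" using assms by simp
  show ?thesis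
    unfolding quad_form_carrier[OF AB] quad_form_carrier[OF assms(1)] quad_form_carrier[OF assms(2)]
    using assms by (simp add: ring_distribs sum.distrib)
qed

lemma quad_form_smult:
  assumes "A \<in> carrier_mat n n"
  shows "quad_form (c \<cdot>\<^sub>m A) x = c * quad_form A x"
proof -
  have cA: "c \<cdot>\<^sub>m A \<in> carrier_mat n n" using assms by simp
  show ?thesis
    unfolding quad_form_carrier[OF cA] quad_form_carrier[OF assms]
    using assms by (simp add: sum_distrib_left mult_ac)
qed

lemma quad_form_adjoint:
  assumes "A \<in> carrier_mat n n"
  shows "quad_form (mat_adjoint A) x = cnj (quad_form A x)"
proof -
  have "quad_form (mat_adjoint A) x = (\<Sum>i<n. \<Sum>j<n. cnj (zcoord x i) * (cnj (A $$ (j, i)) * zcoord x j))"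
    unfolding quad_form_carrier[OF mat_adjoint_carrier[OF assms]]
    using assms by (simp add: mat_adjoint_index sum_distrib_left)
  also have "\<dots> = (\<Sum>j<n. \<Sum>i<n. cnj (zcoord x i) * (cnj (A $$ (j, i)) * zcoord x j))"
    by (rule sum.swap)
  also have "\<dots> = cnj (quad_form A x)"
    unfolding quad_form_carrier[OF assms] by (simp add: sum_distrib_left mult_ac)
  finally show ?thesis .
qed

definition gaussian_abs_moment :: "nat \<Rightarrow> complex mat \<Rightarrow> real" where
  "gaussian_abs_moment d A =
     (\<integral>x. cmod (quad_form A x) ^ d \<partial>complex_gaussian (dim_row A)) / fact d"

lemma integrable_cmod_quad_form_power:
  assumes "A \<in> carrier_mat n n"
  shows "integrable (complex_gaussian n) (\<lambda>x. cmod (quad_form A x) ^ d)"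
proof -
  have "integrable (complex_gaussian n) (\<lambda>x. cmod (quad_form A x ^ d))"
    by (intro integrable_norm complex_gaussian_integrable poly_fun_power poly_fun_quad_form assms)
  then show ?thesis by (simp add: norm_power)
qed

lemma even_cmod_power:
  assumes "even d"
  shows "complex_of_real (cmod z ^ d) = z ^ (d div 2) * cnj z ^ (d div 2)"
proof -
  have "cmod z ^ d = (cmod z ^ 2) ^ (d div 2)"
    using assms by (simp flip: power_mult)
  then have "complex_of_real (cmod z ^ d) = (of_real (cmod z ^ 2)) ^ (d div 2)"
    by simp
  also have "\<dots> = z ^ (d div 2) * cnj z ^ (d div 2)"
    by (simp add: complex_norm_square power_mult_distrib del: of_real_power)
  finally show ?thesis .
qed

text \<open>
  Apply \<open>gaussian_moment_cycle_index\<close> to \<open>A + u A*\<close>.  Both sides are polynomials in \<open>u\<close>, and the claim is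
  the equality of their middle coefficients, divided by a binomial coefficient.
\<close>

lemma sum_trace_poly_eq_gaussian_abs_moment:
  assumes A: "A \<in> carrier_mat n n" and d: "even d"
  shows "(\<Sum>\<pi>\<in>partitions d. trace_poly \<pi> A / of_nat (partition_z \<pi>)) = of_real (gaussian_abs_moment d A)"
proof -
  define E where "E j = (\<integral>x. quad_form A x ^ (d - j) * cnj (quad_form A x) ^ j \<partial>complex_gaussian n)" for j
  define b where "b j = (of_nat (d choose j) / fact d) * E j" for j
  define c where "c j = (\<Sum>\<pi>\<in>partitions d. adjoint_count_sum \<pi> A j / of_nat (partition_z \<pi>))" for j
  have "\<forall>u. (\<Sum>j\<le>d. c j * u ^ j) = (\<Sum>j\<le>d. b j * u ^ j)"
  proof
    fix u
    let ?M = "adjoint_pencil A 1 u"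
    have M: "?M \<in> carrier_mat n n" using A by simp
    have q: "quad_form ?M x = u * cnj (quad_form A x) + quad_form A x" for x
      unfolding adjoint_pencil_def using A
      by (subst quad_form_add[of _ n]) (simp_all add: quad_form_smult[of _ n] quad_form_adjoint[OF A])
    have "(\<Sum>j\<le>d. c j * u ^ j) = (\<Sum>\<pi>\<in>partitions d.
        (\<Sum>j\<le>d. 1 ^ (d - j) * u ^ j * adjoint_count_sum \<pi> A j) / of_nat (partition_z \<pi>))"
      unfolding c_def sum_distrib_right
      by (subst sum.swap) (simp add: sum_divide_distrib mult_ac)
    also have "\<dots> = cycle_index (\<lambda>k. mat_trace (?M ^\<^sub>m k)) d"
      unfolding cycle_index_def
      by (intro sum.cong refl) (simp add: prod_trace_pencil_expansion[OF A] partitions_def)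
    also have "\<dots> = gaussian_moment ?M d"
      by (rule gaussian_moment_cycle_index[OF M, symmetric])
    also have "\<dots> = (\<integral>x. (\<Sum>j\<le>d. (of_nat (d choose j) * u ^ j) *
        (quad_form A x ^ (d - j) * cnj (quad_form A x) ^ j)) \<partial>complex_gaussian n) / fact d"
      using carrier_matD(1)[OF M]
      by (simp add: gaussian_moment_def q binomial_ring power_mult_distrib mult_ac)
    also have "(\<integral>x. (\<Sum>j\<le>d. (of_nat (d choose j) * u ^ j) *
        (quad_form A x ^ (d - j) * cnj (quad_form A x) ^ j)) \<partial>complex_gaussian n) =
        (\<Sum>j\<le>d. (of_nat (d choose j) * u ^ j) * E j)"
    proof -
      have "integrable (complex_gaussian n) (\<lambda>x. quad_form A x ^ (d - j) * cnj (quad_form A x) ^ j)" for j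
        by (intro complex_gaussian_integrable poly_fun_mult poly_fun_power poly_fun_cnj
            poly_fun_quad_form A)
      then show ?thesis by (simp add: E_def Bochner_Integration.integral_sum)
    qed
    also have "\<dots> / fact d = (\<Sum>j\<le>d. b j * u ^ j)"
      by (simp add: b_def sum_divide_distrib mult_ac)
    finally show "(\<Sum>j\<le>d. c j * u ^ j) = (\<Sum>j\<le>d. b j * u ^ j)" .
  qed
  then have cb: "c (d div 2) = b (d div 2)"
    unfolding polyfun_eq_coeffs by simp
  have "E (d div 2) = (\<integral>x. complex_of_real (cmod (quad_form A x) ^ d) \<partial>complex_gaussian n)"
  proof -
    have "d - d div 2 = d div 2" using d by presburger
    then show ?thesis unfolding E_def even_cmod_power[OF d] by simp
  qed
  also have "\<dots> = of_real (\<integral>x. cmod (quad_form A x) ^ d \<partial>complex_gaussian n)"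
    by (rule integral_complex_of_real)
  finally have Ed: "E (d div 2) / fact d = of_real (gaussian_abs_moment d A)"
    using A by (simp add: gaussian_abs_moment_def)
  have "(\<Sum>\<pi>\<in>partitions d. trace_poly \<pi> A / of_nat (partition_z \<pi>)) =
      c (d div 2) / of_nat (d choose (d div 2))"
    unfolding c_def sum_divide_distrib
    by (intro sum.cong refl) (simp add: trace_poly_adjoint_count_sum partitions_def)
  also have "\<dots> = E (d div 2) / fact d"
    unfolding cb b_def by simp
  finally show ?thesis unfolding Ed .
qed

lemma triple_norm_eq_root_gaussian_abs_moment:
  assumes "A \<in> carrier_mat n n" "even d"
  shows "triple_norm d A = root d (gaussian_abs_moment d A)"
proof -
  have "(\<Sum>\<pi>\<in>partitions d. Re (trace_poly \<pi> A) / real (partition_z \<pi>)) =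
      Re (\<Sum>\<pi>\<in>partitions d. trace_poly \<pi> A / of_nat (partition_z \<pi>))"
    by (simp add: Re_divide_of_nat)
  then show ?thesis
    by (simp add: triple_norm_def sum_trace_poly_eq_gaussian_abs_moment[OF assms])
qed

section \<open>Norm axioms\<close>

text \<open>
  Minkowski's inequality for the measure \<open>M\<close> divided by \<open>K\<close>, where \<open>a\<close> and \<open>b\<close> are positive upper bounds
  for the norms of \<open>f\<close> and \<open>g\<close>; working with bounds avoids treating functions of norm \<open>0\<close> separately.  The function \<open>f + g\<close>,
  divided by \<open>a + b\<close>, is a convex combination of \<open>f / a\<close> and \<open>g / b\<close>, and \<open>t^d\<close> is convex.
\<close>

lemma Minkowski_power_integral_bound:
  fixes f g :: "'a \<Rightarrow> complex"
  assumes int: "integrable M (\<lambda>x. cmod (f x) ^ d)" "integrable M (\<lambda>x. cmod (g x) ^ d)"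
      "integrable M (\<lambda>x. cmod (f x + g x) ^ d)"
    and "even d" "0 < a" "0 < b"
    and f: "(\<integral>x. cmod (f x) ^ d \<partial>M) \<le> a ^ d * K" and g: "(\<integral>x. cmod (g x) ^ d \<partial>M) \<le> b ^ d * K"
  shows "(\<integral>x. cmod (f x + g x) ^ d \<partial>M) \<le> (a + b) ^ d * K"
proof -
  define s where "s = a / (a + b)"
  have s: "0 \<le> s" "0 \<le> 1 - s" "1 - s = b / (a + b)"
    using assms(5,6) by (simp_all add: s_def field_simps)
  have pt: "cmod (f x + g x) ^ d \<le> (a + b) ^ d * (s * (cmod (f x) ^ d / a ^ d) + (1 - s) * (cmod (g x) ^ d / b ^ d))" for x
  proof -
    have "cmod (f x + g x) ^ d \<le> (cmod (f x) + cmod (g x)) ^ d"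
      by (intro power_mono norm_triangle_ineq norm_ge_zero)
    also have "cmod (f x) + cmod (g x) = (a + b) * (s * (cmod (f x) / a) + (1 - s) * (cmod (g x) / b))"
    proof -
      have "(a + b) * s = a" "(a + b) * (1 - s) = b"
        unfolding s(3) using assms(5,6) by (simp_all add: s_def)
      then have "(a + b) * (s * (cmod (f x) / a) + (1 - s) * (cmod (g x) / b)) =
          a * (cmod (f x) / a) + b * (cmod (g x) / b)"
        by (simp only: distrib_left mult.assoc[symmetric])
      then show ?thesis using assms(5,6) by simp
    qed
    also have "\<dots> ^ d = (a + b) ^ d * (s * (cmod (f x) / a) + (1 - s) * (cmod (g x) / b)) ^ d"
      by (rule power_mult_distrib)
    also have "\<dots> \<le> (a + b) ^ d * (s * (cmod (f x) / a) ^ d + (1 - s) * (cmod (g x) / b) ^ d)"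
      using convex_onD[OF convex_power_even[OF assms(4)], of "1 - s" "cmod (f x) / a" "cmod (g x) / b"] s(1,2) assms(5,6)
      by (intro mult_left_mono) auto
    finally show ?thesis by (simp add: power_divide)
  qed
  have "(\<integral>x. cmod (f x + g x) ^ d \<partial>M) \<le>
      (\<integral>x. (a + b) ^ d * (s * (cmod (f x) ^ d / a ^ d) + (1 - s) * (cmod (g x) ^ d / b ^ d)) \<partial>M)"
    using int pt by (intro integral_mono) auto
  also have "\<dots> = (a + b) ^ d * (s * ((\<integral>x. cmod (f x) ^ d \<partial>M) / a ^ d) + (1 - s) * ((\<integral>x. cmod (g x) ^ d \<partial>M) / b ^ d))"
    using int by simp
  also have "\<dots> \<le> (a + b) ^ d * (s * K + (1 - s) * K)"
    using f g s assms(5,6)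
    by (intro mult_left_mono add_mono) (auto simp: divide_le_eq mult.commute)
  finally show ?thesis by (simp add: algebra_simps)
qed

lemma gaussian_abs_moment_nonneg: "0 \<le> gaussian_abs_moment d A"
  unfolding gaussian_abs_moment_def by (intro divide_nonneg_pos integral_nonneg) auto

text \<open>
  The bounds \<open>a\<close> and \<open>b\<close> are the two norms enlarged by \<open>e / 2\<close>, which makes them positive.
\<close>

lemma root_gaussian_abs_moment_triangle:
  assumes A: "A \<in> carrier_mat n n" and B: "B \<in> carrier_mat n n" and d: "even d" "0 < d"
  shows "root d (gaussian_abs_moment d (A + B)) \<le>
    root d (gaussian_abs_moment d A) + root d (gaussian_abs_moment d B)"
proof (rule field_le_epsilon)
  fix e :: real assume e: "0 < e"
  define N where "N A = root d (gaussian_abs_moment d A)" for A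
  define a where "a = N A + e / 2"
  define b where "b = N B + e / 2"
  have N0: "0 \<le> N A" for A
    unfolding N_def using d by (simp add: gaussian_abs_moment_nonneg)
  have AB: "A + B \<in> carrier_mat n n" using A B by simp
  have ab: "0 < a" "0 < b" using N0[of A] N0[of B] e by (simp_all add: a_def b_def)
  have moment: "(\<integral>x. cmod (quad_form C x) ^ d \<partial>complex_gaussian n) = N C ^ d * fact d"
    if "C \<in> carrier_mat n n" for C
    using that d gaussian_abs_moment_nonneg[of d C]
    by (simp add: N_def gaussian_abs_moment_def)
  have "(\<integral>x. cmod (quad_form A x + quad_form B x) ^ d \<partial>complex_gaussian n) \<le> (a + b) ^ d * fact d"
  proof (rule Minkowski_power_integral_bound[OF _ _ _ d(1) ab])
    show "integrable (complex_gaussian n) (\<lambda>x. cmod (quad_form A x + quad_form B x) ^ d)"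
      using integrable_cmod_quad_form_power[OF AB] by (simp add: quad_form_add[OF A B])
    show "(\<integral>x. cmod (quad_form A x) ^ d \<partial>complex_gaussian n) \<le> a ^ d * fact d"
      unfolding moment[OF A] using N0[of A] e by (auto simp: a_def intro!: power_mono)
    show "(\<integral>x. cmod (quad_form B x) ^ d \<partial>complex_gaussian n) \<le> b ^ d * fact d"
      unfolding moment[OF B] using N0[of B] e by (auto simp: b_def intro!: power_mono)
  qed (use integrable_cmod_quad_form_power A B in auto)
  then have "N (A + B) ^ d \<le> (a + b) ^ d"
    using moment[OF AB] by (simp add: quad_form_add[OF A B])
  then have "N (A + B) \<le> a + b"
    using power_mono_iff[of "N (A + B)" "a + b" d] N0[of "A + B"] ab d(2) by linarith
  then show "root d (gaussian_abs_moment d (A + B)) \<le>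
      root d (gaussian_abs_moment d A) + root d (gaussian_abs_moment d B) + e"
    by (simp add: N_def a_def b_def)
qed

text \<open>
  One step of the recursion for the pair of \<open>A*\<close> and \<open>A\<close>.
\<close>

lemma gaussian_quad_form_second_moment:
  assumes A: "A \<in> carrier_mat n n"
  shows "(\<integral>x. quad_form (mat_adjoint A) x * quad_form A x \<partial>complex_gaussian n) =
    of_real ((cmod (mat_trace A))\<^sup>2 + (\<Sum>i<n. \<Sum>k<n. (cmod (A $$ (i, k)))\<^sup>2))"
proof -
  have A': "mat_adjoint A \<in> carrier_mat n n" and AA: "A * mat_adjoint A \<in> carrier_mat n n"
    using A by (simp_all add: mult_carrier_mat[of _ n n _ n])
  have mean: "(\<integral>x. quad_form C x \<partial>complex_gaussian n) = mat_trace C" if "C \<in> carrier_mat n n" for C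
    using gaussian_quad_form_recursion[OF that A, of 0]
      prob_space.prob_space[OF prob_space_gaussian_on, of "{..<n} \<times> (UNIV :: bool set)"] by simp
  have "(\<integral>x. quad_form (mat_adjoint A) x * quad_form A x \<partial>complex_gaussian n) =
      cnj (mat_trace A) * mat_trace A + mat_trace (A * mat_adjoint A)"
    using gaussian_quad_form_recursion[OF A' A, of 1] mean[OF A] mean[OF AA]
    by (simp add: mat_trace_adjoint[OF A])
  also have "mat_trace (A * mat_adjoint A) = (\<Sum>i<n. \<Sum>k<n. of_real ((cmod (A $$ (i, k)))\<^sup>2))"
    using carrier_matD[OF A] A
    by (simp add: mat_trace_def mult_mat_index[OF A A'] mat_adjoint_index complex_norm_square
        del: index_mult_mat(1) of_real_power)
  also have "cnj (mat_trace A) * mat_trace A = of_real ((cmod (mat_trace A))\<^sup>2)"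
    by (simp only: complex_norm_square mult.commute)
  finally show ?thesis by simp
qed

text \<open>
  If the \<open>d\<close>-th absolute moment vanishes, then so does the form almost everywhere, and with it the
  second moment, which bounds the squared modulus of every entry of \<open>A\<close>.
\<close>

lemma gaussian_abs_moment_eq_0_iff:
  assumes A: "A \<in> carrier_mat n n" and d: "0 < d"
  shows "gaussian_abs_moment d A = 0 \<longleftrightarrow> A = 0\<^sub>m n n"
proof
  assume "gaussian_abs_moment d A = 0"
  then have "(\<integral>x. cmod (quad_form A x) ^ d \<partial>complex_gaussian n) = 0"
    using A by (simp add: gaussian_abs_moment_def)
  then have "AE x in complex_gaussian n. cmod (quad_form A x) ^ d = 0"
    using integral_nonneg_eq_0_iff_AE[OF integrable_cmod_quad_form_power[OF A]] by simp
  then have "AE x in complex_gaussian n. quad_form (mat_adjoint A) x * quad_form A x = 0"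
    by eventually_elim (use d in simp)
  then have "(\<integral>x. quad_form (mat_adjoint A) x * quad_form A x \<partial>complex_gaussian n) = 0"
    by (rule integral_eq_zero_AE)
  then have "(cmod (mat_trace A))\<^sup>2 + (\<Sum>i<n. \<Sum>k<n. (cmod (A $$ (i, k)))\<^sup>2) = 0"
    unfolding gaussian_quad_form_second_moment[OF A] by (simp only: of_real_eq_0_iff)
  moreover have "0 \<le> (\<Sum>i<n. \<Sum>k<n. (cmod (A $$ (i, k)))\<^sup>2)"
    by (intro sum_nonneg) simp
  ultimately have "(\<Sum>i<n. \<Sum>k<n. (cmod (A $$ (i, k)))\<^sup>2) = 0"
    by (smt (verit) zero_le_power2)
  then have "\<forall>i<n. \<forall>k<n. A $$ (i, k) = 0"
    by (simp add: sum_nonneg_eq_0_iff sum_nonneg)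
  then show "A = 0\<^sub>m n n"
    using A by (intro eq_matI) auto
next
  assume "A = 0\<^sub>m n n"
  then show "gaussian_abs_moment d A = 0"
    using d by (simp add: gaussian_abs_moment_def quad_form_def)
qed

lemma gaussian_abs_moment_smult:
  assumes A: "A \<in> carrier_mat n n"
  shows "gaussian_abs_moment d (c \<cdot>\<^sub>m A) = cmod c ^ d * gaussian_abs_moment d A"
  by (simp add: gaussian_abs_moment_def quad_form_smult[OF A] norm_mult power_mult_distrib)

lemma mat_norm_on_triple_norm:
  assumes "0 < d" "even d"
  shows "mat_norm_on UNIV n (carrier_mat n n) (triple_norm d)"
proof -
  note eq = triple_norm_eq_root_gaussian_abs_moment[OF _ assms(2)]
  show ?thesis
    unfolding mat_norm_on_def
  proof (intro conjI ballI)
    fix A :: "complex mat" assume A: "A \<in> carrier_mat n n"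
    show "0 \<le> triple_norm d A"
      using assms(1) by (simp add: eq[OF A] gaussian_abs_moment_nonneg)
    show "triple_norm d A = 0 \<longleftrightarrow> A = 0\<^sub>m n n"
      using assms(1) by (simp add: eq[OF A] gaussian_abs_moment_eq_0_iff[OF A])
    show "triple_norm d (c \<cdot>\<^sub>m A) = cmod c * triple_norm d A" for c
    proof -
      have "c \<cdot>\<^sub>m A \<in> carrier_mat n n" using A by simp
      then show ?thesis
        using assms(1)
        by (simp add: eq[OF A] eq gaussian_abs_moment_smult[OF A] real_root_mult real_root_power_cancel)
    qed
    fix B :: "complex mat" assume B: "B \<in> carrier_mat n n"
    have "A + B \<in> carrier_mat n n" using A B by simp
    then show "triple_norm d (A + B) \<le> triple_norm d A + triple_norm d B"
      using root_gaussian_abs_moment_triangle[OF A B assms(2,1)] by (simp add: eq[OF A] eq[OF B] eq)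
  qed
qed

section \<open>Hermitian matrices\<close>

lemma mat_trace_mult_commute:
  fixes A B :: "'a::comm_semiring_0 mat"
  assumes A: "A \<in> carrier_mat n n" and B: "B \<in> carrier_mat n n"
  shows "mat_trace (A * B) = mat_trace (B * A)"
proof -
  have idx: "mat_trace (C * D) = (\<Sum>i<n. \<Sum>k<n. C $$ (i, k) * D $$ (k, i))"
    if "C \<in> carrier_mat n n" "D \<in> carrier_mat n n" for C D :: "'a mat"
    using that by (simp add: mat_trace_def scalar_prod_def row_def col_def atLeast0LessThan)
  show ?thesis
    unfolding idx[OF A B] idx[OF B A] by (subst sum.swap) (simp add: mult.commute)
qed

lemma upper_triangular_power_index:
  fixes B :: "complex mat"
  assumes B: "B \<in> carrier_mat n n" and ut: "upper_triangular B" and "i < n" "j < n" "j \<le> i"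
  shows "(B ^\<^sub>m k) $$ (i, j) = (if i = j then (B $$ (i, i)) ^ k else 0)"
  using assms(3-)
proof (induction k arbitrary: i j)
  case 0
  then show ?case using B by simp
next
  case (Suc k)
  have Bk: "B ^\<^sub>m k \<in> carrier_mat n n" by (rule pow_carrier_mat[OF B])
  have "(B ^\<^sub>m Suc k) $$ (i, j) = (\<Sum>l<n. (B ^\<^sub>m k) $$ (i, l) * B $$ (l, j))"
    using Suc.prems by (simp add: mult_mat_index[OF Bk B] del: index_mult_mat(1))
  also have "\<dots> = (\<Sum>l<n. if l = i then (B $$ (i, i)) ^ k * B $$ (i, j) else 0)"
  proof (rule sum.cong[OF refl])
    fix l assume "l \<in> {..<n}"
    then have l: "l < n" by simp
    show "(B ^\<^sub>m k) $$ (i, l) * B $$ (l, j) = (if l = i then (B $$ (i, i)) ^ k * B $$ (i, j) else 0)"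
    proof (cases "l \<le> i")
      case True
      then show ?thesis using Suc.IH[of i l] Suc.prems l by auto
    next
      case False
      then have "B $$ (l, j) = 0"
        using ut B l Suc.prems unfolding upper_triangular_def by auto
      then show ?thesis using False by simp
    qed
  qed
  also have "\<dots> = (B $$ (i, i)) ^ k * B $$ (i, j)"
    using Suc.prems by simp
  finally show ?case
    using Suc.prems ut B unfolding upper_triangular_def by auto
qed

text \<open>
  By Schur's theorem \<open>A\<close> is similar to an upper triangular matrix with diagonal \<open>es\<close>, and powers of
  triangular matrices act entrywise on the diagonal.
\<close>

lemma mat_trace_power_eq_sum_eigenvalues:
  fixes A :: "complex mat"
  assumes A: "A \<in> carrier_mat n n" and es: "char_poly A = (\<Prod>e\<leftarrow>es. [:- e, 1:])"
  shows "mat_trace (A ^\<^sub>m k) = (\<Sum>e\<leftarrow>es. e ^ k)"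
proof -
  obtain B P Q where "schur_decomposition A es = (B, P, Q)"
    by (cases "schur_decomposition A es")
  from schur_decomposition[OF A es this]
  have wit: "similar_mat_wit A B P Q" and ut: "upper_triangular B" and diag: "diag_mat B = es"
    by auto
  from similar_mat_witD2[OF A wit]
  have QP: "Q * P = 1\<^sub>m n" and B: "B \<in> carrier_mat n n" and P: "P \<in> carrier_mat n n" and Q: "Q \<in> carrier_mat n n"
    by auto
  have Bk: "B ^\<^sub>m k \<in> carrier_mat n n" by (rule pow_carrier_mat[OF B])
  have "mat_trace (A ^\<^sub>m k) = mat_trace (P * B ^\<^sub>m k * Q)"
    by (simp only: similar_mat_wit_pow_id[OF wit])
  also have "\<dots> = mat_trace (Q * (P * B ^\<^sub>m k))"
    using P Q Bk by (intro mat_trace_mult_commute[of _ n]) auto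
  also have "Q * (P * B ^\<^sub>m k) = B ^\<^sub>m k"
    by (simp only: assoc_mult_mat[OF Q P Bk, symmetric] QP left_mult_one_mat[OF Bk])
  also have "mat_trace (B ^\<^sub>m k) = (\<Sum>i<n. (B $$ (i, i)) ^ k)"
    using carrier_matD(1)[OF Bk] upper_triangular_power_index[OF B ut] by (simp add: mat_trace_def)
  also have "\<dots> = (\<Sum>e\<leftarrow>diag_mat B. e ^ k)"
    using B by (simp add: diag_mat_def comp_def interv_sum_list_conv_sum_set_nat atLeast0LessThan)
  finally show ?thesis unfolding diag .
qed

lemma hermitian_char_poly:
  assumes A: "A \<in> hermitian_mats n"
  shows "char_poly A = (\<Prod>e\<leftarrow>map complex_of_real (eigvals_desc A). [:- e, 1:])"
proof -
  have Ac: "A \<in> carrier_mat n n" using A by (auto simp: hermitian_mats_def)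
  have "char_poly A = (\<Prod>e\<in>#proots (char_poly A). [:- e, 1:])"
    using complex_poly_decompose_multiset[of "char_poly A"] degree_monic_char_poly[OF Ac] by simp
  also have "proots (char_poly A) = mset (map complex_of_real (eigvals_desc A))"
    using hermitian_eigvals_desc(1)[OF A] by simp
  finally show ?thesis by (simp only: mset_map[symmetric] prod_mset_prod_list)
qed

lemma hermitian_mat_trace_power:
  assumes A: "A \<in> hermitian_mats n"
  shows "mat_trace (A ^\<^sub>m k) = (\<Sum>i=1..n. complex_of_real (eigval i A) ^ k)"
proof -
  have Ac: "A \<in> carrier_mat n n" using A by (auto simp: hermitian_mats_def)
  have "mat_trace (A ^\<^sub>m k) = (\<Sum>i<n. complex_of_real (eigvals_desc A ! i) ^ k)"
    unfolding mat_trace_power_eq_sum_eigenvalues[OF Ac hermitian_char_poly[OF A]]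
    using hermitian_eigvals_desc(2)[OF A]
    by (simp add: sum_list_sum_nth atLeast0LessThan)
  also have "\<dots> = (\<Sum>i=1..n. complex_of_real (eigval i A) ^ k)"
    by (rule sum.reindex_bij_witness[of _ "\<lambda>i. i - 1" Suc]) (auto simp: eigval_def)
  finally show ?thesis .
qed

lemma complete_hom_of_real:
  "complete_hom d n (\<lambda>i. complex_of_real (x i)) = of_real (complete_hom d n x)"
proof -
  have "(\<Prod>i\<leftarrow>is. complex_of_real (x i)) = of_real (\<Prod>i\<leftarrow>is. x i)" for "is" :: "nat list"
    by (induction "is") simp_all
  then show ?thesis by (simp add: complete_hom_def)
qed

text \<open>
  The form of a Hermitian matrix is real, so its even absolute moments are its moments.  These obey
  the same Newton recursion as the complete homogeneous polynomials of the eigenvalues.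
\<close>

lemma hermitian_gaussian_abs_moment:
  assumes A: "A \<in> hermitian_mats n" and d: "even d"
  shows "gaussian_abs_moment d A = complete_hom d n (\<lambda>i. eigval i A)"
proof -
  have Ac: "A \<in> carrier_mat n n" and adj: "mat_adjoint A = A"
    using A by (auto simp: hermitian_mats_def)
  have "complex_of_real (cmod (quad_form A x) ^ d) = quad_form A x ^ d" for x
  proof -
    have "cnj (quad_form A x) = quad_form A x"
      using quad_form_adjoint[OF Ac, of x] adj by simp
    then show ?thesis
      using d unfolding even_cmod_power[OF d] by (simp flip: power_add mult_2)
  qed
  then have "complex_of_real (gaussian_abs_moment d A) = gaussian_moment A d"
    unfolding gaussian_abs_moment_def gaussian_moment_def
    by (simp flip: integral_complex_of_real)
  also have "\<dots> = complete_hom d n (\<lambda>i. complex_of_real (eigval i A))"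
  proof (rule newton_recursion_unique[where a = "gaussian_moment A" and
        b = "\<lambda>m. complete_hom m n (\<lambda>i. complex_of_real (eigval i A))" and
        p = "\<lambda>k. mat_trace (A ^\<^sub>m k)"])
    show "of_nat (Suc m) * complete_hom (Suc m) n (\<lambda>i. complex_of_real (eigval i A)) =
        (\<Sum>k\<le>m. mat_trace (A ^\<^sub>m Suc k) * complete_hom (m - k) n (\<lambda>i. complex_of_real (eigval i A)))" for m
      unfolding hermitian_mat_trace_power[OF A] by (rule complete_hom_newton)
  qed (simp_all only: gaussian_moment_0 complete_hom_0 gaussian_moment_newton[OF Ac])
  finally show ?thesis
    unfolding complete_hom_of_real of_real_eq_iff .
qed

lemma triple_norm_hermitian:
  assumes "A \<in> hermitian_mats n" "even d"
  shows "triple_norm d A = hermitian_chs_norm d n A"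
proof -
  have "A \<in> carrier_mat n n" using assms(1) by (auto simp: hermitian_mats_def)
  then show ?thesis
    by (simp add: triple_norm_eq_root_gaussian_abs_moment[OF _ assms(2)] hermitian_chs_norm_def
        hermitian_gaussian_abs_moment[OF assms])
qed

lemma hermitian_mats_add:
  assumes "A \<in> hermitian_mats n" "B \<in> hermitian_mats n"
  shows "A + B \<in> hermitian_mats n"
proof -
  have AB: "A \<in> carrier_mat n n" "B \<in> carrier_mat n n" "mat_adjoint A = A" "mat_adjoint B = B"
    using assms by (auto simp: hermitian_mats_def)
  have "cnj (C $$ (j, i)) = C $$ (i, j)" if "C \<in> carrier_mat n n" "mat_adjoint C = C" "i < n" "j < n" for C i j
    using mat_adjoint_index[of i C j] that by simp
  then have "mat_adjoint (A + B) = A + B"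
    using AB by (intro eq_matI) (auto simp: mat_adjoint_index)
  then show ?thesis using AB by (simp add: hermitian_mats_def)
qed

lemma hermitian_mats_smult:
  assumes "A \<in> hermitian_mats n" "c \<in> \<real>"
  shows "c \<cdot>\<^sub>m A \<in> hermitian_mats n"
proof -
  have A: "A \<in> carrier_mat n n" "mat_adjoint A = A"
    using assms by (auto simp: hermitian_mats_def)
  have "cnj (A $$ (j, i)) = A $$ (i, j)" if "i < n" "j < n" for i j
    using mat_adjoint_index[of i A j] that A by simp
  moreover have "cnj c = c" using assms(2) Reals_cnj_iff by blast
  ultimately have "mat_adjoint (c \<cdot>\<^sub>m A) = c \<cdot>\<^sub>m A"
    using A(1) by (intro eq_matI) (auto simp: mat_adjoint_index)
  then show ?thesis using A by (simp add: hermitian_mats_def)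
qed

theorem theorem3:
  fixes n d :: nat
  assumes "n \<ge> 1" and "d \<ge> 2" and "even d"
  shows "(\<forall>\<pi>\<in>partitions d. \<forall>A\<in>carrier_mat n n. trace_poly \<pi> A \<in> \<real>)
    \<and> mat_norm_on UNIV n (carrier_mat n n) (triple_norm d)
    \<and> mat_norm_on \<real> n (hermitian_mats n) (hermitian_chs_norm d n)
    \<and> (\<forall>A\<in>hermitian_mats n. triple_norm d A = hermitian_chs_norm d n A)"
proof (intro conjI)
  have norm: "mat_norm_on UNIV n (carrier_mat n n) (triple_norm d)"
    using assms by (intro mat_norm_on_triple_norm) auto
  have herm: "hermitian_chs_norm d n A = triple_norm d A" if "A \<in> hermitian_mats n" for A
    using triple_norm_hermitian[OF that assms(3)] by simp
  have sub: "A \<in> carrier_mat n n" if "A \<in> hermitian_mats n" for A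
    using that by (auto simp: hermitian_mats_def)
  show "\<forall>\<pi>\<in>partitions d. \<forall>A\<in>carrier_mat n n. trace_poly \<pi> A \<in> \<real>"
    using assms(3) by (auto simp: partitions_def intro!: trace_poly_real)
  show "mat_norm_on UNIV n (carrier_mat n n) (triple_norm d)" by (rule norm)
  show "\<forall>A\<in>hermitian_mats n. triple_norm d A = hermitian_chs_norm d n A"
    by (simp add: herm)
  show "mat_norm_on \<real> n (hermitian_mats n) (hermitian_chs_norm d n)"
    using norm unfolding mat_norm_on_def
    by (simp add: herm sub hermitian_mats_add hermitian_mats_smult)
qed

end
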